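(* Let $\Omega\subseteq\mathbb{R}^n$ be open, $\nu,C_1,\dots,C_{n-1}\in\mathcal{C}^\infty(\Omega,\mathbb{R})$, $H:=C_{n-1}$, and $X$ the vector field on $\Omega$ with components $X_i=\nu\cdot\frac{\partial(C_1,\dots,C_{n-2},x_i,H)}{\partial(x_1,\dots,x_n)}$. Let $\overline{x}_e\in\mathcal{E}^{C_{n-1}}_{C_1,\dots,C_{n-2}}$ be a non-degenerate regular equilibrium point of $X$. Then the characteristic polynomial of the linearization $\mathfrak{L}^X(\overline{x}_e)$ is $$p_{\mathfrak{L}^X(\overline{x}_e)}(\mu)=\det(\mathfrak{L}^X(\overline{x}_e)-\mu I_n)=(-\mu)^{n-2}\left(\mu^2+\mathcal{I}_X(\overline{x}_e)\right).$$ Moreover, if $\mathcal{I}_X(\overline{x}_e)<0$, then $\overline{x}_e$ is unstable.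
   Context: $\langle\cdot,\cdot\rangle$ is the standard inner product on $\mathbb{R}^n$, $\nabla$ the gradient, and $\frac{\partial(\cdots)}{\partial(x_1,\dots,x_n)}$ a Jacobian determinant. For decomposable $k$-vectors, $\langle u_1\wedge\dots\wedge u_k,v_1\wedge\dots\wedge v_k\rangle_k:=\det[\langle u_i,v_j\rangle]$. $\mathcal{E}^{C_{n-1}}_{C_1,\dots,C_{n-2}}:=\{\overline{x}\in\Omega:\nu(\overline{x})\neq0,\ \nabla C_1\wedge\dots\wedge\nabla C_{n-2}(\overline{x})\neq0,\ \nabla C_1\wedge\dots\wedge\nabla C_{n-1}(\overline{x})=0\}$ (regular equilibria). For $\overline{x}_e$ in it, let $\overrightarrow{\lambda_e}\in\mathbb{R}^{n-2}$ be the unique vector with $\nabla H(\overline{x}_e)+\sum_i\lambda^e_i\nabla C_i(\overline{x}_e)=0$, $F_{\overrightarrow{\lambda_e}}:=H+\sum_i\lambda^e_iC_i$; $\overline{x}_e$ is non-degenerate if $A:=\operatorname{Hess}F_{\overrightarrow{\lambda_e}}(\overline{x}_e)=\mathrm{D}(\nabla F_{\overrightarrow{\lambda_e}})(\overline{x}_e)$ is invertible, and then $\mathcal{I}_X(\overline{x}_e):=\nu^2(\overline{x}_e)\det(A)\langle A^{-1}\nabla C_1(\overline{x}_e)\wedge\dots\wedge A^{-1}\nabla C_{n-2}(\overline{x}_e),\nabla C_1(\overline{x}_e)\wedge\dots\wedge\nabla C_{n-2}(\overline{x}_e)\rangle_{n-2}$. The linearization at an equilibrium is $\mathfrak{L}^X(\overline{x}_e)v:=\frac{\mathrm{d}}{\mathrm{d}t}(\mathrm{D}F^X_t(\overline{x}_e)v)|_{t=0}$,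 $F^X_t$ the flow of $X$. *)

theory Defs
  imports "HOL-Analysis.Analysis"
begin

text \<open>Euclidean space R^n is modelled as real^'n, with 'n a finite linearly ordered
  index type; the order on 'n fixes the numbering x_1,...,x_n of coordinates.\<close>

definition coord_pos :: "'n::{finite,linorder} \<Rightarrow> nat" where
  "coord_pos r = card {s. s < r}"

definition grad :: "(real^'n \<Rightarrow> real) \<Rightarrow> real^'n \<Rightarrow> real^'n" where
  "grad f x = (\<chi> j. frechet_derivative f (at x) (axis j 1))"

definition hess :: "(real^'n \<Rightarrow> real) \<Rightarrow> real^'n \<Rightarrow> real^'n^'n" where
  "hess f x = (\<chi> i j. frechet_derivative (\<lambda>y. grad f y $ i) (at x) (axis j 1))"

fun Ck_on :: "nat \<Rightarrow> (real^'n) set \<Rightarrow> (real^'n \<Rightarrow> real) \<Rightarrow> bool" where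
  "Ck_on 0 S f = continuous_on S f"
| "Ck_on (Suc k) S f =
     (\<exists>f'. (\<forall>x\<in>S. (f has_derivative f' x) (at x)) \<and> (\<forall>j. Ck_on k S (\<lambda>x. f' x (axis j 1))))"

definition smooth_on :: "(real^'n) set \<Rightarrow> (real^'n \<Rightarrow> real) \<Rightarrow> bool" where
  "smooth_on S f = (\<forall>k. Ck_on k S f)"

definition det_nat :: "nat \<Rightarrow> (nat \<Rightarrow> nat \<Rightarrow> real) \<Rightarrow> real" where
  "det_nat k A = (\<Sum>p | p permutes {..<k}. of_int (sign p) * (\<Prod>i<k. A i (p i)))"

definition jac_det :: "(real^('n::{finite,linorder}) \<Rightarrow> real) list \<Rightarrow> real^('n::{finite,linorder}) \<Rightarrow> real" where
  "jac_det fs x = det (\<chi> r c. grad (fs ! coord_pos r) x $ c)"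

text \<open>Decomposable k-vector u_0 wedge ... wedge u_(k-1), in Pluecker coordinates:
  the coordinate at a k-subset I of the indices is the k x k minor on the columns I.\<close>
definition wedge :: "nat \<Rightarrow> (nat \<Rightarrow> real^('n::{finite,linorder})) \<Rightarrow> ('n::{finite,linorder}) set \<Rightarrow> real" where
  "wedge k u I = (if card I = k then det_nat k (\<lambda>a b. u a $ (sorted_list_of_set I ! b)) else 0)"

definition hfield :: "(real^('n::{finite,linorder}) \<Rightarrow> real) \<Rightarrow> (nat \<Rightarrow> real^('n::{finite,linorder}) \<Rightarrow> real) \<Rightarrow> real^('n::{finite,linorder}) \<Rightarrow> real^('n::{finite,linorder})" where
  "hfield \<nu> C x = (\<chi> c. \<nu> x * jac_det (map C [1..<CARD('n) - 1] @ [(\<lambda>y. y $ c), C (CARD('n) - 1)]) x)"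

definition regular_equilibria :: "(real^('n::{finite,linorder})) set \<Rightarrow> (real^('n::{finite,linorder}) \<Rightarrow> real) \<Rightarrow> (nat \<Rightarrow> real^('n::{finite,linorder}) \<Rightarrow> real) \<Rightarrow> (real^('n::{finite,linorder})) set" where
  "regular_equilibria \<Omega> \<nu> C = {x\<in>\<Omega>. \<nu> x \<noteq> 0
      \<and> wedge (CARD('n) - 2) (\<lambda>a. grad (C (a+1)) x) \<noteq> (\<lambda>_. 0)
      \<and> wedge (CARD('n) - 1) (\<lambda>a. grad (C (a+1)) x) = (\<lambda>_. 0)}"

definition lagrange_F :: "(nat \<Rightarrow> real^('n::{finite,linorder}) \<Rightarrow> real) \<Rightarrow> (nat \<Rightarrow> real) \<Rightarrow> real^('n::{finite,linorder}) \<Rightarrow> real" where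
  "lagrange_F C lam y = C (CARD('n) - 1) y + (\<Sum>i=1..CARD('n) - 2. lam i * C i y)"

definition IX :: "(real^('n::{finite,linorder}) \<Rightarrow> real) \<Rightarrow> (nat \<Rightarrow> real^('n::{finite,linorder}) \<Rightarrow> real) \<Rightarrow> (nat \<Rightarrow> real) \<Rightarrow> real^('n::{finite,linorder}) \<Rightarrow> real" where
  "IX \<nu> C lam xe = (let A = hess (lagrange_F C lam) xe in
     (\<nu> xe)^2 * det A *
     det_nat (CARD('n) - 2) (\<lambda>a b. (matrix_inv A *v grad (C (a+1)) xe) \<bullet> grad (C (b+1)) xe))"

text \<open>(D, Phi) is the (maximal) flow of the vector field X on Omega: D is the flow domain,
  Phi t x is the value of the maximal solution through x at time t.\<close>
definition is_flow :: "(real^'n \<Rightarrow> real^'n) \<Rightarrow> (real^'n) set \<Rightarrow> (real \<times> (real^'n)) set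
     \<Rightarrow> (real \<Rightarrow> real^'n \<Rightarrow> real^'n) \<Rightarrow> bool" where
  "is_flow X \<Omega> D \<Phi> \<longleftrightarrow>
     (\<forall>x\<in>\<Omega>. (0, x) \<in> D \<and> \<Phi> 0 x = x \<and> is_interval {t. (t, x) \<in> D})
   \<and> (\<forall>(t, x)\<in>D. x \<in> \<Omega> \<and> \<Phi> t x \<in> \<Omega> \<and>
        ((\<lambda>s. \<Phi> s x) has_vector_derivative X (\<Phi> t x)) (at t within {s. (s, x) \<in> D}))
   \<and> (\<forall>x\<in>\<Omega>. \<forall>J y. is_interval J \<and> 0 \<in> J \<and> y 0 = x \<and>
        (\<forall>t\<in>J. y t \<in> \<Omega> \<and> (y has_vector_derivative X (y t)) (at t within J))
        \<longrightarrow> (\<forall>t\<in>J. (t, x) \<in> D \<and> \<Phi> t x = y t))"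

definition linearization :: "(real \<Rightarrow> real^'n \<Rightarrow> real^'n) \<Rightarrow> real^'n \<Rightarrow> real^'n \<Rightarrow> real^'n" where
  "linearization \<Phi> xe v = vector_derivative (\<lambda>t. frechet_derivative (\<Phi> t) (at xe) v) (at 0)"

definition lyap_stable :: "(real \<times> (real^'n)) set \<Rightarrow> (real \<Rightarrow> real^'n \<Rightarrow> real^'n) \<Rightarrow> real^'n \<Rightarrow> bool" where
  "lyap_stable D \<Phi> xe \<longleftrightarrow>
     (\<forall>\<epsilon>>0. \<exists>\<delta>>0. \<forall>x. dist x xe < \<delta> \<longrightarrow> (\<forall>t\<ge>0. (t, x) \<in> D \<and> dist (\<Phi> t x) xe < \<epsilon>))"

end

theory Submission
  imports Defs
begin

text \<open>
  Adding multiples of the rows \<open>\<nabla>C\<^sub>i\<close> to the last row of the Jacobian replaces \<open>H\<close> by the Lagrange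
  function \<open>F\<close>, whose gradient vanishes at the equilibrium. Hence the derivative of the field there is
  \<open>L = \<nu> B A\<close>, where \<open>B\<close> is the skew form \<open>det(\<nabla>C\<^sub>1, \<dots>, \<nabla>C\<^bsub>n-2\<^esub>, y, z)\<close> and \<open>A\<close> the (symmetric)
  Hessian of \<open>F\<close>. Completing the \<open>\<nabla>C\<^sub>i\<close> to a basis turns \<open>B\<close> into a multiple of the standard symplectic
  form of a coordinate plane, so the characteristic polynomial is that of a 2 by 2 block; Jacobi's
  complementary minor identity identifies its determinant with \<open>\<I>\<close>, and moreover
  \<open>L\<^sup>3 = - \<I> L\<close>. The linearization of the flow equals \<open>L\<close> by a Gronwall comparison of solutions
  near the equilibrium with those of the linear equation. If \<open>\<I> < 0\<close>, the cubic relation splits the space into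
  three eigenspaces, and a quadratic function growing exponentially along solutions rules out stability.
\<close>

section \<open>Determinants with prescribed rows\<close>

lemma det_nat_cong:
  assumes "\<And>a b. a < k \<Longrightarrow> b < k \<Longrightarrow> A a b = B a b"
  shows "det_nat k A = det_nat k B"
proof -
  have "A i (\<pi> i) = B i (\<pi> i)" if "\<pi> permutes {..<k}" "i < k" for \<pi> i
    using assms that permutes_in_image[OF that(1), of i] by simp
  then show ?thesis by (simp add: det_nat_def)
qed

text \<open>In the Leibniz sum a permutation that moves an index outside \<open>{p, q}\<close> meets
  a zero entry, so only the identity and the transposition of \<open>p\<close> and \<open>q\<close>
  survive. The scale \<open>d\<close> will be 1 for minors and \<open>- \<mu>\<close> for the
  characteristic polynomial.\<close>

lemma det_axis_rows_outside_pair: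
  fixes A :: "real^'n^'n"
  assumes "p \<noteq> q" and rows: "\<And>i. i \<noteq> p \<Longrightarrow> i \<noteq> q \<Longrightarrow> A $ i = d *s axis i 1"
  shows "det A = d ^ (CARD('n) - 2) * (A$p$p * A$q$q - A$p$q * A$q$p)"
proof -
  let ?t = "\<lambda>\<sigma>. of_int (sign \<sigma>) * (\<Prod>i\<in>UNIV. A $ i $ \<sigma> i)"
  let ?\<tau> = "Transposition.transpose p q"
  have other: "?t \<sigma> = 0" if "\<sigma> permutes UNIV" "\<sigma> \<noteq> id" "\<sigma> \<noteq> ?\<tau>" for \<sigma>
  proof -
    have "\<exists>i. i \<noteq> p \<and> i \<noteq> q \<and> \<sigma> i \<noteq> i"
    proof (rule ccontr)
      assume "\<not> ?thesis"
      then have "\<sigma> permutes {p, q}"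
        using that(1) unfolding permutes_def by auto
      then show False
        using that(2,3) by (auto simp: permutes_doubleton_iff id_def)
    qed
    then obtain i where "i \<noteq> p" "i \<noteq> q" "\<sigma> i \<noteq> i" by blast
    then have "A $ i $ \<sigma> i = 0" by (simp add: rows axis_def)
    then show ?thesis by (simp add: prod_zero_iff) (metis)
  qed
  have split: "prod f UNIV = f p * f q * prod f (UNIV - {p, q})" for f :: "'n \<Rightarrow> real"
  proof -
    have "UNIV = insert p (insert q (UNIV - {p,q}))" by auto
    then have "prod f UNIV = prod f (insert p (insert q (UNIV - {p,q})))" by simp
    also have "\<dots> = f p * f q * prod f (UNIV - {p, q})"
      using \<open>p \<noteq> q\<close> by (subst prod.insert, simp, simp, subst prod.insert) auto
    finally show ?thesis .
  qed
  have card: "card (UNIV - {p, q}) = CARD('n) - 2"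
    using \<open>p \<noteq> q\<close> by (subst card_Diff_subset) auto
  have rest: "(\<Prod>i\<in>UNIV - {p,q}. A $ i $ \<sigma> i) = d ^ (CARD('n) - 2)"
    if "\<And>i. i \<noteq> p \<Longrightarrow> i \<noteq> q \<Longrightarrow> \<sigma> i = i" for \<sigma>
    using that card by (simp add: rows)
  have ne: "id \<noteq> ?\<tau>"
    using \<open>p \<noteq> q\<close> by (metis id_apply transpose_apply_first)
  have "det A = (\<Sum>\<sigma> | \<sigma> permutes UNIV. ?t \<sigma>)"
    by (simp add: det_def)
  also have "\<dots> = (\<Sum>\<sigma>\<in>{id, ?\<tau>}. ?t \<sigma>)"
    by (rule sum.mono_neutral_right)
       (use other in \<open>auto simp: permutes_id permutes_swap_id\<close>)
  also have "\<dots> = ?t id + ?t ?\<tau>"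
    using ne by simp
  also have "\<dots> = d ^ (CARD('n) - 2) * (A$p$p * A$q$q - A$p$q * A$q$p)"
    using \<open>p \<noteq> q\<close> by (simp add: split rest sign_swap_id algebra_simps)
  finally show ?thesis .
qed

text \<open>Again only the permutations that fix every index outside \<open>T\<close> survive, and
  \<open>f\<close> carries the permutations of \<open>{..<k}\<close> to them. This connects
  \<open>det\<close> with the \<open>det_nat\<close> of \<open>wedge\<close> and
  \<open>IX\<close>.\<close>

lemma det_axis_rows_eq_det_nat:
  fixes A :: "real^'n^'n" and f :: "nat \<Rightarrow> 'n"
  assumes f: "bij_betw f {..<k} T" and rows: "\<And>i. i \<notin> T \<Longrightarrow> A $ i = axis i 1"
  shows "det A = det_nat k (\<lambda>a b. A $ f a $ f b)"
proof -
  let ?t = "\<lambda>\<sigma>. of_int (sign \<sigma>) * (\<Prod>i\<in>UNIV. A $ i $ \<sigma> i)"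
  have other: "?t \<sigma> = 0" if "\<sigma> permutes UNIV" "\<not> \<sigma> permutes T" for \<sigma>
  proof -
    have "\<not> (\<forall>x. x \<notin> T \<longrightarrow> \<sigma> x = x)"
      using that unfolding permutes_def by simp
    then obtain i where "i \<notin> T" "\<sigma> i \<noteq> i" by blast
    then have "A $ i $ \<sigma> i = 0" by (simp add: rows axis_def)
    then show ?thesis by (simp add: prod_zero_iff) (metis)
  qed
  have inj: "inj_on f {..<k}" and im: "f ` {..<k} = T"
    using f by (auto simp: bij_betw_def)
  \<comment> \<open>Conjugation of \<pi> by \<open>f\<close>, extended by the identity outside
    \<open>T\<close>; the locale interpreted below shows that it preserves the sign.\<close>
  define g where "g = (\<lambda>\<pi> x. if x \<in> T then f (\<pi> (inv_into {..<k} f x)) else x)"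
  have "det A = (\<Sum>\<sigma> | \<sigma> permutes UNIV. ?t \<sigma>)"
    by (simp add: det_def)
  also have "\<dots> = (\<Sum>\<sigma> | \<sigma> permutes T. ?t \<sigma>)"
    by (rule sum.mono_neutral_right)
       (use other in \<open>auto intro: permutes_subset\<close>)
  also have "\<dots> = (\<Sum>\<pi> | \<pi> permutes {..<k}. ?t (g \<pi>))"
    unfolding g_def by (rule sum.reindex_bij_betw[OF bij_betw_permutations[OF f], symmetric])
  also have "\<dots> = (\<Sum>\<pi> | \<pi> permutes {..<k}. of_int (sign \<pi>) * (\<Prod>i<k. A $ f i $ f (\<pi> i)))"
  proof (rule sum.cong[OF refl])
    fix \<pi> assume "\<pi> \<in> {\<pi>. \<pi> permutes {..<k}}"
    then have \<pi>: "\<pi> permutes {..<k}" by simp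
    interpret permutes_bij_finite \<pi> "{..<k}" T f "inv_into {..<k} f" "g \<pi>"
      by unfold_locales (use f \<pi> inj in \<open>auto simp: g_def fun_eq_iff\<close>)
    have "(\<Prod>i\<in>UNIV. A $ i $ g \<pi> i) = (\<Prod>i\<in>T. A $ i $ g \<pi> i)"
      by (rule prod.mono_neutral_right) (auto simp: g_def rows)
    also have "\<dots> = (\<Prod>i<k. A $ f i $ g \<pi> (f i))"
      by (rule prod.reindex_bij_betw[OF f, symmetric])
    also have "\<dots> = (\<Prod>i<k. A $ f i $ f (\<pi> i))"
      by (rule prod.cong) (use inj im in \<open>auto simp: g_def\<close>)
    finally show "?t (g \<pi>) = of_int (sign \<pi>) * (\<Prod>i<k. A $ f i $ f (\<pi> i))"
      by (simp add: sign_p')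
  qed
  also have "\<dots> = det_nat k (\<lambda>a b. A $ f a $ f b)"
    by (simp add: det_nat_def)
  finally show ?thesis .
qed

section \<open>The determinant as a form in two of its rows\<close>

text \<open>As a function of \<open>y\<close> and \<open>z\<close> this is, up to sign, the volume
  form contracted with the n-2 vectors \<open>c r\<close>; the rows \<open>p\<close> and
  \<open>q\<close> of \<open>c\<close> are overwritten.\<close>

definition det_with_rows ::
    "'n \<Rightarrow> 'n \<Rightarrow> ('n \<Rightarrow> real^'n) \<Rightarrow> real^'n \<Rightarrow> real^'n \<Rightarrow> real" where
  "det_with_rows p q c y z = det (\<chi> r. if r = p then y else if r = q then z else c r)"

text \<open>The matrix on the left is \<open>K ** M\<close>, where \<open>K\<close> has rows
  \<open>y\<close>, \<open>z\<close> at \<open>p\<close>, \<open>q\<close> and unit rows elsewhere: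
  a unit row of \<open>K\<close> selects a row of \<open>M\<close>, which there is
  \<open>c r\<close>. The determinant of \<open>K\<close> is a 2 by 2 minor.\<close>

lemma det_with_rows_change_basis:
  fixes c :: "'n \<Rightarrow> real^'n"
  assumes "p \<noteq> q" and M: "M = (\<chi> r. if r = p then a else if r = q then b else c r)"
  shows "det_with_rows p q c (transpose M *v y) (transpose M *v z)
      = (y$p * z$q - y$q * z$p) * det M"
proof -
  define K :: "real^'n^'n" where "K = (\<chi> r. if r = p then y else if r = q then z else axis r 1)"
  have "(K ** M) $ r = (if r = p then transpose M *v y else if r = q then transpose M *v z else c r)" for r
  proof -
    have row: "(K ** M) $ r = transpose M *v (K $ r)" for r
      by (simp add: vec_eq_iff matrix_vector_mult_def matrix_matrix_mult_def transpose_def mult.commute)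
    have ax: "transpose M *v axis r 1 = M $ r"
      by (simp add: vec_eq_iff matrix_vector_mult_def transpose_def axis_def if_distrib sum.delta cong: if_cong)
    show ?thesis unfolding row using ax by (simp add: K_def M)
  qed
  then have "det_with_rows p q c (transpose M *v y) (transpose M *v z) = det (K ** M)"
    unfolding det_with_rows_def by (intro arg_cong[where f=det]) (simp add: vec_eq_iff)
  also have "\<dots> = det K * det M" by (rule det_mul)
  also have "det K = y$p * z$q - y$q * z$p"
    using det_axis_rows_outside_pair[OF \<open>p \<noteq> q\<close>, of K 1] \<open>p \<noteq> q\<close> by (simp add: K_def)
  finally show ?thesis .
qed

lemma det_with_rows_linear_last:
  fixes c :: "'n \<Rightarrow> real^'n"
  assumes "p \<noteq> q"
  shows "linear (det_with_rows p q c y)"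
proof (rule linearI)
  have eq: "(\<chi> r. if r = p then y else if r = q then z else c r)
      = (\<chi> r. if r = q then z else if r = p then y else c r)" for z
    using assms by (auto simp: vec_eq_iff)
  show "det_with_rows p q c y (u + v) = det_with_rows p q c y u + det_with_rows p q c y v" for u v
    unfolding det_with_rows_def eq by (rule det_row_add)
  show "det_with_rows p q c y (s *\<^sub>R u) = s *\<^sub>R det_with_rows p q c y u" for s u
    unfolding det_with_rows_def eq
    using det_row_mul[of q s "\<lambda>_. u" "\<lambda>r. if r = p then y else c r"]
    by (simp add: scalar_mult_eq_scaleR cong: if_cong)
qed

lemma det_with_rows_eq_0:
  assumes "p \<noteq> q" "r \<noteq> p" "r \<noteq> q"
  shows "det_with_rows p q c y (c r) = 0"
  unfolding det_with_rows_def
  by (rule det_identical_rows[of q r]) (use assms in \<open>auto simp: row_def\<close>)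

text \<open>Let \<open>Q\<close> be the inverse \<open>R\<close> with its rows \<open>p\<close> and
  \<open>q\<close> replaced by unit rows. Then \<open>Q ** G\<close> has the rows of
  \<open>G\<close> at \<open>p\<close>, \<open>q\<close> and unit rows elsewhere, so
  \<open>det Q\<close> and \<open>det (Q ** G)\<close> both collapse to minors.\<close>

lemma jacobi_complementary_minor:
  fixes G R :: "real^'n^'n" and f :: "nat \<Rightarrow> 'n"
  assumes "p \<noteq> q" and RG: "R ** G = mat 1" and f: "bij_betw f {..<k} (UNIV - {p, q})"
  shows "G$p$p * G$q$q - G$p$q * G$q$p = det G * det_nat k (\<lambda>a b. R $ f a $ f b)"
proof -
  define Q :: "real^'n^'n" where "Q = (\<chi> r. if r = p \<or> r = q then axis r 1 else R $ r)"
  have fpq: "f a \<noteq> p \<and> f a \<noteq> q" if "a < k" for a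
    using f that by (auto simp: bij_betw_def)
  have QG: "(Q ** G) $ r = (if r = p \<or> r = q then G $ r else axis r 1)" for r
  proof (cases "r = p \<or> r = q")
    case True
    then show ?thesis
      by (auto simp: vec_eq_iff matrix_matrix_mult_def Q_def axis_def if_distrib[of "\<lambda>x. x * _"] sum.delta cong: if_cong)
  next
    case False
    then have "(Q ** G) $ r = (R ** G) $ r"
      by (simp add: vec_eq_iff matrix_matrix_mult_def Q_def)
    with False show ?thesis by (simp add: RG mat_def axis_def vec_eq_iff eq_commute)
  qed
  have "det Q = det_nat k (\<lambda>a b. Q $ f a $ f b)"
    by (rule det_axis_rows_eq_det_nat[OF f]) (auto simp: Q_def)
  also have "\<dots> = det_nat k (\<lambda>a b. R $ f a $ f b)"
    by (rule det_nat_cong) (auto simp: Q_def dest: fpq)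
  finally have "det Q = det_nat k (\<lambda>a b. R $ f a $ f b)" .
  moreover have "det (Q ** G) = G$p$p * G$q$q - G$p$q * G$q$p"
    using det_axis_rows_outside_pair[OF \<open>p \<noteq> q\<close>, of "Q ** G" 1] by (simp add: QG)
  ultimately show ?thesis by (simp add: det_mul mult.commute)
qed

lemma bij_betw_coord_pos: "bij_betw coord_pos (UNIV :: 'n::{finite,linorder} set) {..<CARD('n)}"
proof -
  have less: "coord_pos r < coord_pos s" if "r < s" for r s :: 'n
    unfolding coord_pos_def
    by (rule psubset_card_mono) (use that in \<open>auto intro: less_trans\<close>)
  have inj: "inj (coord_pos :: 'n \<Rightarrow> nat)"
    by (rule injI) (metis less less_irrefl neqE)
  have "coord_pos r < CARD('n)" for r :: 'n
    unfolding coord_pos_def by (rule psubset_card_mono) auto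
  then have "range (coord_pos :: 'n \<Rightarrow> nat) \<subseteq> {..<CARD('n)}" by auto
  then have "range (coord_pos :: 'n \<Rightarrow> nat) = {..<CARD('n)}"
    using inj by (intro card_subset_eq) (auto simp: card_image)
  with inj show ?thesis by (simp add: bij_betw_def)
qed

text \<open>A nonzero coordinate of the wedge is a nonzero minor on the columns \<open>I\<close>.
  Bordering it with the unit vectors of the two missing columns gives a nonsingular matrix, so these
  unit vectors serve as \<open>a\<close> and \<open>b\<close>.\<close>

lemma wedge_nonzero_imp_det_with_rows_nonzero:
  fixes u :: "nat \<Rightarrow> real^('n::{finite,linorder})" and p q :: "'n::{finite,linorder}"
  assumes wedge: "wedge (CARD('n) - 2) u \<noteq> (\<lambda>_. 0)" and "CARD('n) \<ge> 2"
    and p: "coord_pos p = CARD('n) - 2" and q: "coord_pos q = CARD('n) - 1"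
    and f: "bij_betw f {..<CARD('n) - 2} (UNIV - {p, q})"
    and pos_f: "\<And>a. a < CARD('n) - 2 \<Longrightarrow> coord_pos (f a) = a"
  shows "\<exists>a b. det_with_rows p q (\<lambda>r. u (coord_pos r)) a b \<noteq> 0"
proof -
  let ?k = "CARD('n) - 2"
  have "p \<noteq> q" using p q \<open>CARD('n) \<ge> 2\<close> by auto
  obtain I where "wedge ?k u I \<noteq> 0" using wedge by auto
  then have cI: "card I = ?k" and
    minor: "det_nat ?k (\<lambda>a b. u a $ (sorted_list_of_set I ! b)) \<noteq> 0"
    by (auto simp: wedge_def split: if_splits)
  have "card (- I) = 2"
    using cI \<open>CARD('n) \<ge> 2\<close> by (simp add: Compl_eq_Diff_UNIV card_Diff_subset)
  then obtain j k where jk: "- I = {j, k}" "j \<noteq> k" by (auto simp: card_2_iff)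
  define xs where "xs = sorted_list_of_set I"
  have xs: "set xs = I" "distinct xs" "length xs = ?k"
    using cI by (auto simp: xs_def)
  \<comment> \<open>A column permutation: \<open>p\<close> and \<open>q\<close> go to the missing
    columns, any other index to the element of \<open>I\<close> whose rank is its position.\<close>
  define g where "g r = (if r = p then j else if r = q then k else xs ! coord_pos r)" for r
  have lt: "coord_pos r < ?k" if "r \<noteq> p" "r \<noteq> q" for r :: 'n
  proof -
    have "r \<in> f ` {..<?k}" using f that by (auto simp: bij_betw_def)
    then show ?thesis using pos_f by auto
  qed
  have gI: "g r \<in> I" if "r \<noteq> p" "r \<noteq> q" for r
    using lt[OF that] that xs by (auto simp: g_def simp flip: xs(1))
  have gjk: "g p = j" "g q = k" using \<open>p \<noteq> q\<close> by (auto simp: g_def)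
  have inj_pos: "r = s" if "coord_pos r = coord_pos s" for r s :: 'n
    using that bij_betw_coord_pos by (metis bij_betw_def injD)
  have "inj g"
  proof (rule injI)
    fix r s assume eq: "g r = g s"
    have jkI: "j \<notin> I" "k \<notin> I" using jk by auto
    show "r = s"
    proof (cases "r = p \<or> r = q \<or> s = p \<or> s = q")
      case True
      then show ?thesis using eq gI gjk jkI jk(2) by metis
    next
      case False
      then have "xs ! coord_pos r = xs ! coord_pos s" using eq by (simp add: g_def)
      then have "coord_pos r = coord_pos s"
        using False lt xs by (simp add: nth_eq_iff_index_eq)
      then show ?thesis by (rule inj_pos)
    qed
  qed
  then have g: "g permutes UNIV"
    by (auto intro!: bij_imp_permutes bijI finite_UNIV_inj_surj)
  define M where
    "M = (\<chi> r :: 'n. if r = p then axis j 1 else if r = q then axis k 1 else u (coord_pos r))"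
  \<comment> \<open>After this permutation the two bordering rows are \<open>axis p 1\<close> and
    \<open>axis q 1\<close>, so the determinant reduces to the chosen minor.\<close>
  define N where "N = (\<chi> i r. M $ i $ g r)"
  have inv: "g r = j \<longleftrightarrow> r = p" "g r = k \<longleftrightarrow> r = q" for r
    using \<open>inj g\<close> gjk by (metis injD)+
  have "det N = det_nat ?k (\<lambda>a b. N $ f a $ f b)"
    by (rule det_axis_rows_eq_det_nat[OF f])
       (use \<open>p \<noteq> q\<close> in \<open>auto simp: N_def M_def axis_def vec_eq_iff inv\<close>)
  also have "\<dots> = det_nat ?k (\<lambda>a b. u a $ (xs ! b))"
  proof -
    have fpq: "f a \<noteq> p \<and> f a \<noteq> q" if "a < ?k" for a
      using f that by (auto simp: bij_betw_def)
    have eq: "N $ f a $ f b = u a $ (xs ! b)" if "a < ?k" "b < ?k" for a b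
      using fpq[OF that(1)] fpq[OF that(2)] that by (simp add: N_def M_def g_def pos_f)
    show ?thesis by (rule det_nat_cong[OF eq])
  qed
  finally have "det N \<noteq> 0" using minor by (simp add: xs_def)
  moreover have "det N = of_int (sign g) * det M"
    unfolding N_def by (rule det_permute_columns[OF g])
  ultimately have "det M \<noteq> 0" by auto
  then show ?thesis unfolding det_with_rows_def M_def by blast
qed

section \<open>Spectrum of the linearized field\<close>

lemma matrix_inv_mult:
  fixes A :: "real^'n^'n"
  assumes "invertible A"
  shows "A ** matrix_inv A = mat 1" "matrix_inv A ** A = mat 1"
proof -
  have "A ** matrix_inv A = mat 1 \<and> matrix_inv A ** A = mat 1"
    unfolding matrix_inv_def by (rule someI_ex[OF assms[unfolded invertible_def]])
  then show "A ** matrix_inv A = mat 1" "matrix_inv A ** A = mat 1" by auto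
qed

text \<open>\<open>L\<close> is conjugate to a matrix \<open>K\<close> whose only nonzero rows are
  \<open>p\<close> and \<open>q\<close>. Symmetry of \<open>A\<close> makes the 2 by 2 block of
  \<open>K\<close> at \<open>p\<close>, \<open>q\<close> trace-free, and Jacobi's identity makes its
  determinant \<open>I\<close>; both conclusions are read off from \<open>K\<close>.\<close>

lemma linear_field_spectrum:
  fixes A L :: "real^'n^'n" and c :: "'n \<Rightarrow> real^'n"
  assumes pq: "p \<noteq> q" and sym: "transpose A = A" and inv: "invertible A"
    and basis: "det_with_rows p q c a b \<noteq> 0"
    and L: "\<And>v i. (L *v v) $ i = \<nu> * det_with_rows p q c (axis i 1) (A *v v)"
    and f: "bij_betw f {..<k} (UNIV - {p, q})"
    and I: "I = \<nu>\<^sup>2 * det A * det_nat k (\<lambda>a b. (matrix_inv A *v c (f a)) \<bullet> c (f b))"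
  shows "det (L - \<mu> *\<^sub>R mat 1) = (- \<mu>) ^ (CARD('n) - 2) * (\<mu>\<^sup>2 + I)"
    and "L *v (L *v (L *v v)) = - I *\<^sub>R (L *v v)"
proof -
  \<comment> \<open>In the coordinates given by the rows of M, the form det(c, y, z) becomes det M times the
    standard symplectic form on the coordinates p, q.\<close>
  define M :: "real^'n^'n" where "M = (\<chi> r. if r = p then a else if r = q then b else c r)"
  have detM: "det M \<noteq> 0" using basis by (simp add: M_def det_with_rows_def)
  then have "invertible M" by (simp add: invertible_det_nz)
  define N where "N = matrix_inv M"
  have MN: "M ** N = mat 1" and NM: "N ** M = mat 1"
    using matrix_inv_mult[OF \<open>invertible M\<close>] by (simp_all add: N_def)
  have tMN: "transpose M ** transpose N = mat 1"
    by (metis NM matrix_transpose_mul transpose_mat)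
  define A' where "A' = matrix_inv A"
  have AA': "A ** A' = mat 1" and A'A: "A' ** A = mat 1"
    using matrix_inv_mult[OF inv] by (simp_all add: A'_def)
  \<comment> \<open>\<open>G\<close> is the bilinear form \<open>A\<close> in the coordinates
    \<open>M *v v\<close>. Outside \<open>p\<close>, \<open>q\<close> the entries of its inverse
    \<open>R\<close> are the pairings of \<open>A' *v c i\<close> with \<open>c j\<close> that occur
    in \<open>I\<close>.\<close>
  define G where "G = transpose N ** A ** N"
  define R where "R = M ** A' ** transpose M"
  have "R ** G = M ** (A' ** ((transpose M ** transpose N) ** (A ** N)))"
    by (simp add: R_def G_def matrix_mul_assoc)
  also have "\<dots> = M ** ((A' ** A) ** N)"
    by (simp add: tMN matrix_mul_assoc)
  finally have RG: "R ** G = mat 1" by (simp add: A'A MN)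
  have "transpose G = G"
    by (simp add: G_def matrix_transpose_mul sym transpose_transpose matrix_mul_assoc)
  then have Gsym: "G $ i $ j = G $ j $ i" for i j
    by (metis transpose_def vec_lambda_beta)
  define \<kappa> where "\<kappa> = \<nu> * det M"
  define d where "d = G$p$p * G$q$q - G$p$q * G$q$p"
  have detG: "det G * (det M)\<^sup>2 = det A"
  proof -
    have "det N * det M = 1" using NM by (metis det_I det_mul)
    then show ?thesis
      by (simp add: G_def det_mul power2_eq_square) (metis (no_types, lifting) mult.assoc mult.commute mult.right_neutral)
  qed
  have fpq: "f x \<noteq> p \<and> f x \<noteq> q" if "x < k" for x
    using f that by (auto simp: bij_betw_def)
  have Rc: "R $ f x $ f y = (A' *v c (f x)) \<bullet> c (f y)" if "x < k" "y < k" for x y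
  proof -
    have "(M ** A' ** transpose M) $ i $ j = (transpose A' *v M $ i) \<bullet> M $ j" for i j
      by (simp add: matrix_matrix_mult_def matrix_vector_mult_def transpose_def inner_vec_def
          sum_distrib_left sum_distrib_right mult_ac)
    moreover have "transpose A' = A'"
    proof -
      have "transpose A' ** A = mat 1" using AA' sym by (metis matrix_transpose_mul transpose_mat)
      then show ?thesis by (metis AA' matrix_mul_assoc matrix_mul_lid matrix_mul_rid)
    qed
    ultimately show ?thesis using fpq that by (simp add: R_def M_def)
  qed
  have "det_nat k (\<lambda>x y. R $ f x $ f y) = det_nat k (\<lambda>a b. (A' *v c (f a)) \<bullet> c (f b))"
    by (rule det_nat_cong[OF Rc])
  then have d: "d = det G * det_nat k (\<lambda>a b. (A' *v c (f a)) \<bullet> c (f b))"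
    using jacobi_complementary_minor[OF pq RG f] by (simp add: d_def)
  \<comment> \<open>The factor \<open>(det M)\<^sup>2\<close> of \<open>\<kappa>\<^sup>2\<close>
    turns \<open>det G\<close> into \<open>det A\<close>.\<close>
  have I_eq: "I = \<kappa>\<^sup>2 * d"
    by (simp add: I d \<kappa>_def power_mult_distrib A'_def flip: detG)
  \<comment> \<open>\<open>\<kappa>\<close> times the standard symplectic matrix of the plane of
    \<open>p\<close> and \<open>q\<close>, multiplied by \<open>G\<close>: row \<open>q\<close> of
    \<open>G\<close> moves to \<open>p\<close>, and row \<open>p\<close>, negated, to
    \<open>q\<close>.\<close>
  define K :: "real^'n^'n" where
    "K = (\<chi> i. if i = p then \<kappa> *s G $ q else if i = q then (- \<kappa>) *s G $ p else 0)"
  have Kv: "K *v y = (\<kappa> * (G *v y) $ q) *s axis p 1 - (\<kappa> * (G *v y) $ p) *s axis q 1" for y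
    using pq by (auto simp: vec_eq_iff K_def matrix_vector_mult_def axis_def sum_distrib_left sum_negf mult.assoc)
  have LNKM: "L *v v = N *v (K *v (M *v v))" for v
  proof -
    define y where "y = G *v (M *v v)"
    have Av: "A *v v = transpose M *v y"
    proof -
      have "transpose M ** (G ** M) = (transpose M ** transpose N) ** A ** (N ** M)"
        by (simp add: G_def matrix_mul_assoc)
      then have "transpose M ** (G ** M) = A" by (simp add: tMN NM)
      then show ?thesis by (simp add: y_def matrix_vector_mul_assoc matrix_mul_assoc)
    qed
    have "(L *v v) $ i = (N *v (K *v (M *v v))) $ i" for i
    proof -
      \<comment> \<open>\<open>e\<close> is row \<open>i\<close> of \<open>N\<close>. Writing
        \<open>axis i 1\<close> as \<open>transpose M *v e\<close> brings both arguments of the form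
        into the shape required by the change of basis.\<close>
      define e where "e = transpose N *v axis i 1"
      have e: "axis i 1 = transpose M *v e"
        by (simp only: e_def matrix_vector_mul_assoc tMN matrix_vector_mul_lid)
      have "e = column i (transpose N)"
        unfolding e_def by (rule matrix_vector_mult_basis)
      then have er: "e $ r = N $ i $ r" for r
        by (simp add: column_def transpose_def)
      have "(L *v v) $ i = \<nu> * ((e$p * y$q - e$q * y$p) * det M)"
        unfolding L Av e by (subst det_with_rows_change_basis[OF pq M_def]) simp
      also have "\<dots> = (N *v (K *v (M *v v))) $ i"
      proof -
        have "(N *v (axis r s)) $ i = N $ i $ r * s" for r s
          by (simp add: matrix_vector_mult_def axis_def if_distrib sum.delta cong: if_cong)
        then have "(N *v (s *s axis r 1)) $ i = N $ i $ r * s" for r s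
          by (simp add: vector_scalar_commute)
        then show ?thesis
          by (simp add: Kv er y_def matrix_vector_mult_diff_distrib \<kappa>_def algebra_simps)
      qed
      finally show ?thesis .
    qed
    then show ?thesis by (simp add: vec_eq_iff)
  qed
  have "L - \<mu> *\<^sub>R mat 1 = N ** (K - \<mu> *\<^sub>R mat 1) ** M"
  proof (rule matrix_eq[THEN iffD2], rule allI)
    fix v
    have "N *v (\<mu> *\<^sub>R (M *v v)) = \<mu> *\<^sub>R v"
      by (simp add: matrix_vector_mult_scaleR matrix_vector_mul_assoc NM)
    then show "(L - \<mu> *\<^sub>R mat 1) *v v = (N ** (K - \<mu> *\<^sub>R mat 1) ** M) *v v"
      by (simp add: LNKM matrix_vector_mult_diff_rdistrib matrix_vector_mult_diff_distrib
          scaleR_matrix_vector_assoc[symmetric] flip: matrix_vector_mul_assoc)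
  qed
  then have "det (L - \<mu> *\<^sub>R mat 1) = det N * det M * det (K - \<mu> *\<^sub>R mat 1)"
    by (simp add: det_mul)
  also have "det N * det M = 1" using NM by (metis det_I det_mul)
  also have "det (K - \<mu> *\<^sub>R mat 1) = (- \<mu>) ^ (CARD('n) - 2) *
     ((\<kappa> * G$q$p - \<mu>) * (- \<kappa> * G$p$q - \<mu>) - (\<kappa> * G$q$q) * (- \<kappa> * G$p$p))"
    using det_axis_rows_outside_pair[OF pq, of "K - \<mu> *\<^sub>R mat 1" "- \<mu>"] pq
    by (simp add: K_def mat_def axis_def vec_eq_iff eq_commute)
  also have "(\<kappa> * G$q$p - \<mu>) * (- \<kappa> * G$p$q - \<mu>) - (\<kappa> * G$q$q) * (- \<kappa> * G$p$p) = \<mu>\<^sup>2 + I"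
    unfolding I_eq d_def Gsym[of q p] by (simp add: algebra_simps power2_eq_square)
  finally show "det (L - \<mu> *\<^sub>R mat 1) = (- \<mu>) ^ (CARD('n) - 2) * (\<mu>\<^sup>2 + I)" by simp
  \<comment> \<open>The range of \<open>K\<close> lies in the plane of \<open>p\<close> and
    \<open>q\<close>, where by Cayley-Hamilton the trace-free block squares to \<open>- I\<close>
    times the identity.\<close>
  have K3: "K *v (K *v (K *v y)) = - I *\<^sub>R (K *v y)" for y
  proof -
    have Gs: "(G *v (s *s axis r 1)) $ i = s * G $ i $ r" for i r s
      by (simp add: vector_scalar_commute matrix_vector_mult_basis column_def)
    have "(K *v (K *v (K *v y))) $ i = (- I *\<^sub>R (K *v y)) $ i" for i
      unfolding Kv I_eq d_def
      by (simp add: matrix_vector_mult_diff_distrib Gs Gsym[of q p]) (simp add: algebra_simps power2_eq_square)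
    then show ?thesis by (simp add: vec_eq_iff)
  qed
  have MNy: "M *v (N *v y) = y" for y
    by (simp add: matrix_vector_mul_assoc MN)
  show "L *v (L *v (L *v v)) = - I *\<^sub>R (L *v v)"
    unfolding LNKM MNy K3 by (simp only: matrix_vector_mult_scaleR)
qed

section \<open>Gradients, Hessians and Lipschitz bounds of smooth functions\<close>

lemma grad_eqI:
  assumes "(f has_derivative (\<lambda>v. u \<bullet> v)) (at x)"
  shows "grad f x = u"
  unfolding grad_def frechet_derivative_at[OF assms, symmetric]
  by (simp add: vec_eq_iff inner_axis)

lemma has_derivative_grad:
  assumes "f differentiable (at x)"
  shows "(f has_derivative (\<lambda>v. grad f x \<bullet> v)) (at x)"
proof -
  let ?f' = "frechet_derivative f (at x)"
  have d: "(f has_derivative ?f') (at x)"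
    using assms by (simp add: frechet_derivative_works)
  interpret linear ?f' using d by (rule has_derivative_linear)
  have "?f' v = grad f x \<bullet> v" for v
  proof -
    have "?f' v = ?f' (\<Sum>j\<in>UNIV. v $ j *s axis j 1)" by (simp add: basis_expansion)
    also have "\<dots> = (\<Sum>j\<in>UNIV. v $ j * ?f' (axis j 1))"
      by (simp add: sum scalar_mult_eq_scaleR scaleR)
    finally show ?thesis by (simp add: grad_def inner_vec_def mult.commute)
  qed
  then have "?f' = (\<lambda>v. grad f x \<bullet> v)" by (rule ext)
  with d show ?thesis by simp
qed

lemma grad_coordinate: "grad (\<lambda>y. y $ c) (x :: real^'n) = axis c 1"
proof (rule grad_eqI)
  have "(\<lambda>v. axis c 1 \<bullet> v) = (\<lambda>v :: real^'n. v $ c)" by (simp add: inner_axis' fun_eq_iff)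
  then show "((\<lambda>y. y $ c) has_derivative (\<lambda>v. axis c 1 \<bullet> v)) (at x)"
    by (simp add: bounded_linear_imp_has_derivative bounded_linear_vec_nth)
qed

lemma Ck_on_cong:
  assumes "open S" "\<And>x. x \<in> S \<Longrightarrow> f x = g x" "Ck_on k S f"
  shows "Ck_on k S g"
proof (cases k)
  case 0
  with assms show ?thesis by (simp cong: continuous_on_cong)
next
  case (Suc m)
  then obtain f' where f': "\<forall>x\<in>S. (f has_derivative f' x) (at x)" "\<forall>j. Ck_on m S (\<lambda>x. f' x (axis j 1))"
    using assms(3) by auto
  have "(g has_derivative f' x) (at x)" if "x \<in> S" for x
    using f'(1) that has_derivative_transform_within_open[OF _ assms(1), of f "f' x" x UNIV g] assms(2) by auto
  with f'(2) Suc show ?thesis by auto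
qed

lemma Ck_on_Suc_imp_differentiable:
  assumes "Ck_on (Suc k) S f" "x \<in> S"
  shows "f differentiable (at x)"
  using assms by (auto simp: differentiable_def)

text \<open>The derivative \<open>f'\<close> hidden in \<open>Ck_on\<close> is unique, so its values
  on unit vectors are the components of \<open>grad\<close>.\<close>

lemma Ck_on_grad:
  assumes "open S" "Ck_on (Suc k) S f"
  shows "Ck_on k S (\<lambda>x. grad f x $ j)"
proof -
  obtain f' where f': "\<forall>x\<in>S. (f has_derivative f' x) (at x)" "\<forall>j. Ck_on k S (\<lambda>x. f' x (axis j 1))"
    using assms(2) by auto
  have eq: "f' x (axis j 1) = grad f x $ j" if "x \<in> S" for x
    using frechet_derivative_at[OF f'(1)[rule_format, OF that]] by (simp add: grad_def)
  show ?thesis by (rule Ck_on_cong[OF assms(1) eq f'(2)[rule_format]])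
qed

lemma Ck_on_add_cmult:
  assumes "Ck_on k S f" "Ck_on k S g"
  shows "Ck_on k S (\<lambda>x. f x + c * g x)"
  using assms
proof (induction k arbitrary: f g)
  case 0
  then show ?case by (auto intro!: continuous_intros)
next
  case (Suc k)
  obtain f' where f': "\<forall>x\<in>S. (f has_derivative f' x) (at x)" "\<forall>j. Ck_on k S (\<lambda>x. f' x (axis j 1))"
    using Suc.prems(1) by auto
  obtain g' where g': "\<forall>x\<in>S. (g has_derivative g' x) (at x)" "\<forall>j. Ck_on k S (\<lambda>x. g' x (axis j 1))"
    using Suc.prems(2) by auto
  have "\<forall>x\<in>S. ((\<lambda>x. f x + c * g x) has_derivative (\<lambda>v. f' x v + c * g' x v)) (at x)"
    using f'(1) g'(1) by (auto intro!: has_derivative_add has_derivative_mult_right)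
  moreover have "\<forall>j. Ck_on k S (\<lambda>x. f' x (axis j 1) + c * g' x (axis j 1))"
    using Suc.IH f'(2) g'(2) by blast
  ultimately show ?case
    unfolding Ck_on.simps by (intro exI[of _ "\<lambda>x v. f' x v + c * g' x v"]) auto
qed

lemma Ck_on_add_sum:
  assumes "finite I" "Ck_on k S f" "\<And>i. i \<in> I \<Longrightarrow> Ck_on k S (g i)"
  shows "Ck_on k S (\<lambda>x. f x + (\<Sum>i\<in>I. c i * g i x))"
  using assms
proof (induction I rule: finite_induct)
  case empty
  then show ?case by simp
next
  case (insert i I)
  then have "Ck_on k S (\<lambda>x. (f x + (\<Sum>i\<in>I. c i * g i x)) + c i * g i x)"
    by (intro Ck_on_add_cmult) auto
  then show ?case using insert.hyps by (simp add: add_ac)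
qed

lemma hess_row: "hess f x $ i = grad (\<lambda>y. grad f y $ i) x"
  by (simp add: hess_def grad_def vec_eq_iff)

lemma has_derivative_grad_nth:
  assumes "open S" "Ck_on (Suc (Suc k)) S f" "x \<in> S"
  shows "((\<lambda>y. grad f y $ i) has_derivative (\<lambda>v. (hess f x *v v) $ i)) (at x)"
proof -
  have "(\<lambda>y. grad f y $ i) differentiable (at x)"
    by (rule Ck_on_Suc_imp_differentiable[OF Ck_on_grad[OF assms(1,2)] assms(3)])
  from has_derivative_grad[OF this] show ?thesis
    by (simp add: hess_row matrix_vector_mul_component)
qed

section \<open>Symmetry of second derivatives\<close>

lemma has_real_derivative_along_line:
  assumes "f differentiable (at (p + s *\<^sub>R e))"
  shows "((\<lambda>s. f (p + s *\<^sub>R e)) has_real_derivative grad f (p + s *\<^sub>R e) \<bullet> e) (at s)"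
proof -
  have "((\<lambda>s. p + s *\<^sub>R e) has_derivative (\<lambda>h. h *\<^sub>R e)) (at s)"
    by (auto intro!: derivative_eq_intros)
  from has_derivative_compose[OF this has_derivative_grad[OF assms]]
  show ?thesis by (simp add: has_field_derivative_def mult_commute_abs)
qed

text \<open>The second difference of \<open>f\<close> over a square of side \<open>t\<close> does
  not depend on the order of the two directions. Two applications of the mean value theorem express
  it as \<open>t\<^sup>2\<close> times a mixed derivative inside the square, and continuity of the
  Hessian lets \<open>t\<close> shrink.\<close>

lemma hess_symmetric:
  fixes f :: "real^'n \<Rightarrow> real"
  assumes S: "open S" and f: "Ck_on (Suc (Suc k)) S f" and x: "x \<in> S"
  shows "hess f x $ i $ j = hess f x $ j $ i"
proof -
  have mean_value: "\<exists>a b. 0 < a \<and> a < t \<and> 0 < b \<and> b < t \<and>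
      f (x + t *\<^sub>R axis i 1 + t *\<^sub>R axis j 1) - f (x + t *\<^sub>R axis i 1) - f (x + t *\<^sub>R axis j 1) + f x
        = t\<^sup>2 * hess f (x + a *\<^sub>R axis i 1 + b *\<^sub>R axis j 1) $ i $ j"
    if t: "0 < t" and sub: "cball x (2 * t) \<subseteq> S" for t :: real and i j
  proof -
    let ?e = "axis i 1 :: real^'n" and ?e' = "axis j 1 :: real^'n"
    have inS: "x + a *\<^sub>R ?e + b *\<^sub>R ?e' \<in> S" if "0 \<le> a" "a \<le> t" "0 \<le> b" "b \<le> t" for a b
    proof -
      have "norm (a *\<^sub>R ?e + b *\<^sub>R ?e') \<le> norm (a *\<^sub>R ?e) + norm (b *\<^sub>R ?e')"
        by (rule norm_triangle_ineq)
      also have "\<dots> \<le> 2 * t" using that by simp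
      finally have "x + (a *\<^sub>R ?e + b *\<^sub>R ?e') \<in> cball x (2 * t)"
        by (metis add_diff_cancel_left' dist_commute dist_norm mem_cball)
      then show ?thesis using sub by (auto simp: add.assoc)
    qed
    have df: "f differentiable (at y)" if "y \<in> S" for y
      using Ck_on_Suc_imp_differentiable[OF f that] .
    have dg: "(\<lambda>y. grad f y $ i) differentiable (at y)" if "y \<in> S" for y
      using Ck_on_Suc_imp_differentiable[OF Ck_on_grad[OF S f] that] .
    \<comment> \<open>The increment of \<open>f\<close> in direction \<open>j\<close>, moved along
      direction \<open>i\<close>; the second difference is an increment of this function.\<close>
    define \<phi> where "\<phi> s = f ((x + t *\<^sub>R ?e') + s *\<^sub>R ?e) - f (x + s *\<^sub>R ?e)" for s
    have d\<phi>: "(\<phi> has_real_derivative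
        grad f ((x + t *\<^sub>R ?e') + s *\<^sub>R ?e) \<bullet> ?e - grad f (x + s *\<^sub>R ?e) \<bullet> ?e) (at s)"
      if "0 \<le> s" "s \<le> t" for s
      unfolding \<phi>_def
      using inS[of s t] inS[of s 0] that t
      by (intro DERIV_diff has_real_derivative_along_line df) (auto simp: add_ac)
    obtain a where a: "0 < a" "a < t"
      "\<phi> t - \<phi> 0 = (t - 0) * (grad f ((x + t *\<^sub>R ?e') + a *\<^sub>R ?e) \<bullet> ?e - grad f (x + a *\<^sub>R ?e) \<bullet> ?e)"
      using MVT2[OF t d\<phi>] by auto
    define \<theta> where "\<theta> s = grad f ((x + a *\<^sub>R ?e) + s *\<^sub>R ?e') $ i" for s
    have d\<theta>: "(\<theta> has_real_derivative hess f ((x + a *\<^sub>R ?e) + s *\<^sub>R ?e') $ i \<bullet> ?e') (at s)"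
      if "0 \<le> s" "s \<le> t" for s
      unfolding \<theta>_def hess_row
      using inS[of a s] that a by (intro has_real_derivative_along_line dg) auto
    obtain b where b: "0 < b" "b < t"
      "\<theta> t - \<theta> 0 = (t - 0) * (hess f ((x + a *\<^sub>R ?e) + b *\<^sub>R ?e') $ i \<bullet> ?e')"
      using MVT2[OF t d\<theta>] by auto
    have "f (x + t *\<^sub>R ?e + t *\<^sub>R ?e') - f (x + t *\<^sub>R ?e) - f (x + t *\<^sub>R ?e') + f x = \<phi> t - \<phi> 0"
      by (simp add: \<phi>_def add_ac)
    also have "\<dots> = t * (\<theta> t - \<theta> 0)"
      unfolding a(3) by (simp add: \<theta>_def inner_axis add_ac)
    also have "\<dots> = t\<^sup>2 * hess f (x + a *\<^sub>R ?e + b *\<^sub>R ?e') $ i $ j"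
      unfolding b(3) by (simp add: inner_axis power2_eq_square)
    finally show ?thesis using a b by blast
  qed
  have cont: "continuous (at x) (\<lambda>y. hess f y $ i $ j)" for i j
  proof -
    have "Ck_on k S (\<lambda>y. hess f y $ i $ j)"
      unfolding hess_row by (intro Ck_on_grad S f)
    then have "continuous_on S (\<lambda>y. hess f y $ i $ j)"
    proof (cases k)
      case (Suc m)
      then show ?thesis
        using \<open>Ck_on k S _\<close> S
        by (auto simp: continuous_on_eq_continuous_at intro: has_derivative_continuous)
    qed simp
    then show ?thesis using S x by (simp add: continuous_on_eq_continuous_at)
  qed
  have "\<bar>hess f x $ i $ j - hess f x $ j $ i\<bar> \<le> 0"
  proof (rule field_le_epsilon)
    fix \<epsilon> :: real assume "0 < \<epsilon>"
    then have \<epsilon>: "0 < \<epsilon> / 2" by simp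
    obtain d1 where d1: "0 < d1" "\<And>y. dist y x < d1 \<Longrightarrow> dist (hess f y $ i $ j) (hess f x $ i $ j) < \<epsilon> / 2"
      using cont[of i j, unfolded continuous_at_eps_delta] \<epsilon> by metis
    obtain d2 where d2: "0 < d2" "\<And>y. dist y x < d2 \<Longrightarrow> dist (hess f y $ j $ i) (hess f x $ j $ i) < \<epsilon> / 2"
      using cont[of j i, unfolded continuous_at_eps_delta] \<epsilon> by metis
    obtain r where r: "0 < r" "cball x r \<subseteq> S" using S x open_contains_cball by blast
    \<comment> \<open>The intermediate points lie within \<open>2 * t\<close> of \<open>x\<close>,
      hence the division by 2.\<close>
    define t where "t = min r (min d1 d2) / 2"
    have t: "0 < t" "2 * t \<le> r" "2 * t \<le> d1" "2 * t \<le> d2" using d1 d2 r by (auto simp: t_def)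
    have sub: "cball x (2 * t) \<subseteq> S" using t(2) r(2) by (auto simp: subset_iff)
    have near: "dist (x + a *\<^sub>R axis i 1 + b *\<^sub>R axis j 1) x < 2 * t"
      if "0 < a" "a < t" "0 < b" "b < t" for a b i j
    proof -
      have "norm (a *\<^sub>R axis i 1 + b *\<^sub>R axis j 1 :: real^'n) \<le> norm (a *\<^sub>R axis i 1 :: real^'n) + norm (b *\<^sub>R axis j 1 :: real^'n)"
        by (rule norm_triangle_ineq)
      also have "\<dots> < 2 * t" using that by simp
      finally show ?thesis by (simp add: dist_norm add.assoc)
    qed
    obtain a b where ab: "0 < a" "a < t" "0 < b" "b < t"
      "f (x + t *\<^sub>R axis i 1 + t *\<^sub>R axis j 1) - f (x + t *\<^sub>R axis i 1) - f (x + t *\<^sub>R axis j 1) + f x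
        = t\<^sup>2 * hess f (x + a *\<^sub>R axis i 1 + b *\<^sub>R axis j 1) $ i $ j"
      using mean_value[OF t(1) sub, of i j] by blast
    obtain a' b' where ab': "0 < a'" "a' < t" "0 < b'" "b' < t"
      "f (x + t *\<^sub>R axis j 1 + t *\<^sub>R axis i 1) - f (x + t *\<^sub>R axis j 1) - f (x + t *\<^sub>R axis i 1) + f x
        = t\<^sup>2 * hess f (x + a' *\<^sub>R axis j 1 + b' *\<^sub>R axis i 1) $ j $ i"
      using mean_value[OF t(1) sub, of j i] by blast
    have "t\<^sup>2 * hess f (x + a *\<^sub>R axis i 1 + b *\<^sub>R axis j 1) $ i $ j
        = t\<^sup>2 * hess f (x + a' *\<^sub>R axis j 1 + b' *\<^sub>R axis i 1) $ j $ i"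
      unfolding ab(5)[symmetric] ab'(5)[symmetric] by (simp add: add_ac)
    then have "hess f (x + a *\<^sub>R axis i 1 + b *\<^sub>R axis j 1) $ i $ j
        = hess f (x + a' *\<^sub>R axis j 1 + b' *\<^sub>R axis i 1) $ j $ i"
      using t(1) by simp
    moreover have "dist (hess f (x + a *\<^sub>R axis i 1 + b *\<^sub>R axis j 1) $ i $ j) (hess f x $ i $ j) < \<epsilon> / 2"
      using near[OF ab(1-4), of i j] t by (intro d1) auto
    moreover have "dist (hess f (x + a' *\<^sub>R axis j 1 + b' *\<^sub>R axis i 1) $ j $ i) (hess f x $ j $ i) < \<epsilon> / 2"
      using near[OF ab'(1-4), of j i] t by (intro d2) auto
    ultimately show "\<bar>hess f x $ i $ j - hess f x $ j $ i\<bar> \<le> 0 + \<epsilon>"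
      unfolding dist_real_def by linarith
  qed
  then show ?thesis by simp
qed

section \<open>Bounded Lipschitz functions\<close>

text \<open>Boundedness is included so that the class is closed under products, and hence under
  determinants.\<close>

definition bdd_lipschitz_on :: "'a::metric_space set \<Rightarrow> ('a \<Rightarrow> real) \<Rightarrow> bool" where
  "bdd_lipschitz_on S f \<longleftrightarrow> (\<exists>B\<ge>0. \<forall>x\<in>S. \<bar>f x\<bar> \<le> B \<and> (\<forall>y\<in>S. \<bar>f x - f y\<bar> \<le> B * dist x y))"

lemma bdd_lipschitz_onI:
  assumes "\<And>x. x \<in> S \<Longrightarrow> \<bar>f x\<bar> \<le> B" "\<And>x y. x \<in> S \<Longrightarrow> y \<in> S \<Longrightarrow> \<bar>f x - f y\<bar> \<le> B' * dist x y"
  shows "bdd_lipschitz_on S f"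
  unfolding bdd_lipschitz_on_def
proof (intro exI conjI ballI)
  show "0 \<le> max 0 (max B B')" by simp
  show "\<bar>f x\<bar> \<le> max 0 (max B B')" if "x \<in> S" for x
    using assms(1)[OF that] by simp
  show "\<bar>f x - f y\<bar> \<le> max 0 (max B B') * dist x y" if "x \<in> S" "y \<in> S" for x y
    by (rule order_trans[OF assms(2)[OF that]]) (intro mult_right_mono, auto)
qed

lemma bdd_lipschitz_on_const: "bdd_lipschitz_on S (\<lambda>x. c)"
  by (rule bdd_lipschitz_onI[of _ _ "\<bar>c\<bar>" 0]) auto

lemma bdd_lipschitz_on_add:
  assumes "bdd_lipschitz_on S f" "bdd_lipschitz_on S g"
  shows "bdd_lipschitz_on S (\<lambda>x. f x + g x)"
proof -
  obtain B where B: "0 \<le> B" "\<And>x. x \<in> S \<Longrightarrow> \<bar>f x\<bar> \<le> B"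
    "\<And>x y. x \<in> S \<Longrightarrow> y \<in> S \<Longrightarrow> \<bar>f x - f y\<bar> \<le> B * dist x y"
    using assms(1) unfolding bdd_lipschitz_on_def by blast
  obtain B' where B': "0 \<le> B'" "\<And>x. x \<in> S \<Longrightarrow> \<bar>g x\<bar> \<le> B'"
    "\<And>x y. x \<in> S \<Longrightarrow> y \<in> S \<Longrightarrow> \<bar>g x - g y\<bar> \<le> B' * dist x y"
    using assms(2) unfolding bdd_lipschitz_on_def by blast
  show ?thesis
  proof (rule bdd_lipschitz_onI)
    show "\<bar>f x + g x\<bar> \<le> B + B'" if "x \<in> S" for x
      using B(2)[OF that] B'(2)[OF that] by linarith
    show "\<bar>f x + g x - (f y + g y)\<bar> \<le> (B + B') * dist x y" if "x \<in> S" "y \<in> S" for x y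
      using B(3)[OF that] B'(3)[OF that] by (simp add: distrib_right)
  qed
qed

lemma bdd_lipschitz_on_mult:
  assumes "bdd_lipschitz_on S f" "bdd_lipschitz_on S g"
  shows "bdd_lipschitz_on S (\<lambda>x. f x * g x)"
proof -
  obtain B where B: "0 \<le> B" "\<And>x. x \<in> S \<Longrightarrow> \<bar>f x\<bar> \<le> B"
    "\<And>x y. x \<in> S \<Longrightarrow> y \<in> S \<Longrightarrow> \<bar>f x - f y\<bar> \<le> B * dist x y"
    using assms(1) unfolding bdd_lipschitz_on_def by blast
  obtain B' where B': "0 \<le> B'" "\<And>x. x \<in> S \<Longrightarrow> \<bar>g x\<bar> \<le> B'"
    "\<And>x y. x \<in> S \<Longrightarrow> y \<in> S \<Longrightarrow> \<bar>g x - g y\<bar> \<le> B' * dist x y"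
    using assms(2) unfolding bdd_lipschitz_on_def by blast
  show ?thesis
  proof (rule bdd_lipschitz_onI)
    show "\<bar>f x * g x\<bar> \<le> B * B'" if "x \<in> S" for x
      unfolding abs_mult using B B' that by (intro mult_mono) auto
    show "\<bar>f x * g x - f y * g y\<bar> \<le> (2 * B * B') * dist x y" if "x \<in> S" "y \<in> S" for x y
    proof -
      have "f x * g x - f y * g y = f x * (g x - g y) + (f x - f y) * g y"
        by (simp add: algebra_simps)
      also have "\<bar>\<dots>\<bar> \<le> \<bar>f x\<bar> * \<bar>g x - g y\<bar> + \<bar>f x - f y\<bar> * \<bar>g y\<bar>"
        by (metis abs_mult abs_triangle_ineq)
      also have "\<dots> \<le> B * (B' * dist x y) + (B * dist x y) * B'"
        using B B' that by (intro add_mono mult_mono) auto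
      finally show ?thesis by (simp add: algebra_simps)
    qed
  qed
qed

lemma bdd_lipschitz_on_sum:
  "(\<And>i. i \<in> I \<Longrightarrow> bdd_lipschitz_on S (f i)) \<Longrightarrow> bdd_lipschitz_on S (\<lambda>x. \<Sum>i\<in>I. f i x)"
  by (induction I rule: infinite_finite_induct)
     (auto intro!: bdd_lipschitz_on_const bdd_lipschitz_on_add)

lemma bdd_lipschitz_on_prod:
  "(\<And>i. i \<in> I \<Longrightarrow> bdd_lipschitz_on S (f i)) \<Longrightarrow> bdd_lipschitz_on S (\<lambda>x. \<Prod>i\<in>I. f i x)"
  by (induction I rule: infinite_finite_induct)
     (auto intro!: bdd_lipschitz_on_const bdd_lipschitz_on_mult)

lemma bdd_lipschitz_on_det:
  assumes "\<And>r s. bdd_lipschitz_on S (\<lambda>x. A x $ r $ s)"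
  shows "bdd_lipschitz_on S (\<lambda>x. det (A x :: real^'n^'n))"
  unfolding det_def
  by (intro bdd_lipschitz_on_sum bdd_lipschitz_on_mult bdd_lipschitz_on_const bdd_lipschitz_on_prod assms)

text \<open>A continuous gradient is bounded on the compact ball, and convexity of the ball turns
  this bound into a Lipschitz constant.\<close>

lemma Ck_on_imp_bdd_lipschitz_on_cball:
  fixes f :: "real^'n \<Rightarrow> real"
  assumes S: "open S" "cball x r \<subseteq> S" and f: "Ck_on (Suc 0) S f"
  shows "bdd_lipschitz_on (cball x r) f"
proof -
  have d: "f differentiable (at y)" if "y \<in> S" for y
    using Ck_on_Suc_imp_differentiable[OF f that] .
  have "continuous_on S (\<lambda>y. grad f y $ j)" for j
    using Ck_on_grad[OF S(1) f, of j] by simp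
  then have "continuous_on (cball x r) (\<lambda>y. \<Sum>j\<in>UNIV. \<bar>grad f y $ j\<bar>)"
    by (intro continuous_on_sum continuous_on_rabs continuous_on_subset[OF _ S(2)])
  then have "bounded ((\<lambda>y. \<Sum>j\<in>UNIV. \<bar>grad f y $ j\<bar>) ` cball x r)"
    by (intro compact_imp_bounded compact_continuous_image) auto
  then obtain K where K: "\<And>y. y \<in> cball x r \<Longrightarrow> (\<Sum>j\<in>UNIV. \<bar>grad f y $ j\<bar>) \<le> K"
    by (force simp: bounded_iff)
  have gK: "norm (grad f y) \<le> K" if "y \<in> cball x r" for y
    using norm_le_l1_cart[of "grad f y"] K[OF that] by linarith
  have "continuous_on (cball x r) f"
    using S d by (meson continuous_at_imp_continuous_on differentiable_imp_continuous_within subsetD)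
  then have "bounded (f ` cball x r)"
    by (intro compact_imp_bounded compact_continuous_image) auto
  then obtain B where B: "\<And>y. y \<in> cball x r \<Longrightarrow> \<bar>f y\<bar> \<le> B"
    by (force simp: bounded_iff)
  show ?thesis
  proof (rule bdd_lipschitz_onI[OF B])
    fix y z assume yz: "y \<in> cball x r" "z \<in> cball x r"
    have "norm (f y - f z) \<le> K * norm (y - z)"
    proof (rule differentiable_bound[of "cball x r"])
      show "(f has_derivative (\<lambda>v. grad f u \<bullet> v)) (at u within cball x r)" if "u \<in> cball x r" for u
        by (rule has_derivative_at_withinI[OF has_derivative_grad[OF d]]) (use that S(2) in blast)
      show "onorm (\<lambda>v. grad f u \<bullet> v) \<le> K" if "u \<in> cball x r" for u
      proof (rule onorm_le)
        fix v
        have "norm (grad f u \<bullet> v) \<le> norm (grad f u) * norm v"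
          using Cauchy_Schwarz_ineq2 by simp
        also have "\<dots> \<le> K * norm v" by (intro mult_right_mono gK that) simp
        finally show "norm (grad f u \<bullet> v) \<le> K * norm v" .
      qed
    qed (use yz in auto)
    then show "\<bar>f y - f z\<bar> \<le> K * dist y z" by (simp add: dist_norm)
  qed
qed

lemma bdd_lipschitz_on_cball_imp_isCont:
  assumes "bdd_lipschitz_on (cball x r) f" "0 < r"
  shows "isCont f x"
proof -
  obtain B where B: "0 \<le> B" "\<And>y. y \<in> cball x r \<Longrightarrow> \<bar>f y - f x\<bar> \<le> B * dist y x"
    using assms unfolding bdd_lipschitz_on_def by (metis centre_in_cball less_imp_le)
  have "((\<lambda>y. B * dist y x) \<longlongrightarrow> B * dist x x) (at x)"
    by (intro tendsto_intros)
  then have lim: "((\<lambda>y. B * dist y x) \<longlongrightarrow> 0) (at x)" by simp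
  have "((\<lambda>y. f y - f x) \<longlongrightarrow> 0) (at x)"
  proof (rule Lim_null_comparison[OF _ lim])
    have "norm (f y - f x) \<le> B * dist y x" if "dist y x < r" for y
      using B(2)[of y] that by (simp add: dist_commute)
    then show "\<forall>\<^sub>F y in at x. norm (f y - f x) \<le> B * dist y x"
      using assms(2) by (auto simp: eventually_at)
  qed
  then show ?thesis by (simp add: isCont_def LIM_zero_iff)
qed

lemma bdd_lipschitz_on_vec:
  fixes X :: "real^'n \<Rightarrow> real^'n"
  assumes "\<And>i. bdd_lipschitz_on S (\<lambda>x. X x $ i)"
  shows "\<exists>K\<ge>0. \<forall>x\<in>S. \<forall>y\<in>S. norm (X x - X y) \<le> K * norm (x - y)"
proof -
  have "\<forall>i. \<exists>B\<ge>0. \<forall>x\<in>S. \<forall>y\<in>S. \<bar>X x $ i - X y $ i\<bar> \<le> B * dist x y"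
    using assms unfolding bdd_lipschitz_on_def by blast
  then obtain B where B: "\<And>i. 0 \<le> B i"
    "\<And>i x y. x \<in> S \<Longrightarrow> y \<in> S \<Longrightarrow> \<bar>X x $ i - X y $ i\<bar> \<le> B i * dist x y"
    by metis
  show ?thesis
  proof (intro exI[of _ "\<Sum>i\<in>UNIV. B i"] conjI ballI)
    show "0 \<le> (\<Sum>i\<in>UNIV. B i)" by (intro sum_nonneg B)
    fix x y assume "x \<in> S" "y \<in> S"
    have "norm (X x - X y) \<le> (\<Sum>i\<in>UNIV. \<bar>(X x - X y) $ i\<bar>)" by (rule norm_le_l1_cart)
    also have "\<dots> \<le> (\<Sum>i\<in>UNIV. B i * dist x y)"
      by (intro sum_mono) (simp add: B \<open>x \<in> S\<close> \<open>y \<in> S\<close>)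
    finally show "norm (X x - X y) \<le> (\<Sum>i\<in>UNIV. B i) * norm (x - y)"
      by (simp add: dist_norm sum_distrib_right)
  qed
qed

text \<open>Continuity of \<open>k\<close> suffices because \<open>h x = 0\<close>: the error is
  \<open>k y\<close> times the remainder of \<open>h\<close> plus
  \<open>(k y - k x) * h' (y - x)\<close>, and both are small compared with
  \<open>y - x\<close>.\<close>

lemma has_derivative_mult_vanishing:
  fixes h k :: "'a::real_normed_vector \<Rightarrow> real"
  assumes k: "isCont k x" and h: "(h has_derivative h') (at x)" and "h x = 0"
  shows "((\<lambda>y. k y * h y) has_derivative (\<lambda>v. k x * h' v)) (at x)"
proof -
  have bl: "bounded_linear h'" using h by (rule has_derivative_bounded_linear)
  obtain K where K: "0 \<le> K" "\<And>v. norm (h' v) \<le> norm v * K"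
    using bounded_linear.nonneg_bounded[OF bl] by blast
  let ?N = "\<lambda>y. norm ((h y - h x) - h' (y - x)) / norm (y - x)"
  have N: "(?N \<longlongrightarrow> 0) (at x)" using h by (simp add: has_derivative_iff_norm)
  have kx: "(k \<longlongrightarrow> k x) (at x)" using k by (simp add: isCont_def)
  have lim: "((\<lambda>y. \<bar>k y\<bar> * ?N y + \<bar>k y - k x\<bar> * K) \<longlongrightarrow> \<bar>k x\<bar> * 0 + \<bar>k x - k x\<bar> * K) (at x)"
    by (intro tendsto_intros N kx)
  have "((\<lambda>y. norm ((k y * h y - k x * h x) - k x * h' (y - x)) / norm (y - x)) \<longlongrightarrow> 0) (at x)"
  proof (rule Lim_null_comparison)
    show "((\<lambda>y. \<bar>k y\<bar> * ?N y + \<bar>k y - k x\<bar> * K) \<longlongrightarrow> 0) (at x)" using lim by simp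
    have "norm ((k y * h y - k x * h x) - k x * h' (y - x)) / norm (y - x)
        \<le> \<bar>k y\<bar> * ?N y + \<bar>k y - k x\<bar> * K" if "y \<noteq> x" for y
    proof -
      have "(k y * h y - k x * h x) - k x * h' (y - x)
          = k y * ((h y - h x) - h' (y - x)) + (k y - k x) * h' (y - x)"
        by (simp add: \<open>h x = 0\<close> algebra_simps)
      also have "norm \<dots> \<le> \<bar>k y\<bar> * norm ((h y - h x) - h' (y - x)) + \<bar>k y - k x\<bar> * norm (h' (y - x))"
        by (metis abs_mult norm_triangle_ineq real_norm_def)
      also have "\<dots> \<le> \<bar>k y\<bar> * norm ((h y - h x) - h' (y - x)) + \<bar>k y - k x\<bar> * (norm (y - x) * K)"
        by (intro add_left_mono mult_left_mono K) simp
      finally show ?thesis using that by (simp add: field_simps)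
    qed
    then show "\<forall>\<^sub>F y in at x. norm (norm ((k y * h y - k x * h x) - k x * h' (y - x)) / norm (y - x))
        \<le> \<bar>k y\<bar> * ?N y + \<bar>k y - k x\<bar> * K"
      by (auto simp: eventually_at_filter)
  qed
  moreover have "bounded_linear (\<lambda>v. k x * h' v)" using bl by (rule bounded_linear_const_mult)
  ultimately show ?thesis by (simp add: has_derivative_iff_norm)
qed

section \<open>Ordinary differential equations\<close>

text \<open>Stated for the squared norm, which is differentiable even where the solution vanishes.\<close>

lemma gronwall_forward:
  fixes w :: "real \<Rightarrow> 'a::real_inner"
  assumes K: "0 \<le> K"
    and deriv: "\<And>t. t \<in> {0..T} \<Longrightarrow> (w has_vector_derivative w' t) (at t within {0..T})"
    and bound: "\<And>t. t \<in> {0..T} \<Longrightarrow> norm (w' t) \<le> K * norm (w t) + \<epsilon>"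
    and t: "t \<in> {0..T}"
  shows "(norm (w t))\<^sup>2 \<le> ((norm (w 0))\<^sup>2 + \<epsilon>\<^sup>2) * exp ((2 * K + 1) * t)"
proof -
  \<comment> \<open>The derivative of the squared norm of \<open>w\<close> contains the mixed term
    \<open>2 * \<epsilon> * norm (w s)\<close>; bounding it by the sum of the two squares costs the
    extra 1 in \<open>c\<close>. With this rate \<phi> is nonincreasing.\<close>
  define c where "c = 2 * K + 1"
  define \<phi> where "\<phi> s = exp (- c * s) * (w s \<bullet> w s + \<epsilon>\<^sup>2)" for s
  have d: "(\<phi> has_real_derivative
       exp (- c * s) * (2 * (w s \<bullet> w' s) - c * (w s \<bullet> w s + \<epsilon>\<^sup>2))) (at s within {0..T})"
    if "s \<in> {0..T}" for s
  proof -
    note dw = deriv[OF that, unfolded has_vector_derivative_def]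
    show ?thesis
      unfolding \<phi>_def has_field_derivative_def
      by (rule derivative_eq_intros dw refl | simp)+
         (auto simp: fun_eq_iff algebra_simps inner_commute)
  qed
  have le: "2 * (w s \<bullet> w' s) - c * (w s \<bullet> w s + \<epsilon>\<^sup>2) \<le> 0" if "s \<in> {0..T}" for s
  proof -
    have 1: "w s \<bullet> w' s \<le> norm (w s) * (K * norm (w s) + \<epsilon>)"
      using norm_cauchy_schwarz[of "w s" "w' s"] bound[OF that]
      by (smt (verit, ccfv_SIG) mult_left_mono norm_ge_zero)
    have 2: "2 * (norm (w s) * (K * norm (w s) + \<epsilon>)) \<le> c * (w s \<bullet> w s) + \<epsilon>\<^sup>2"
      using sum_squares_ge_zero[of "norm (w s) - \<epsilon>" 0]
      by (simp add: c_def dot_square_norm power2_eq_square algebra_simps)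
    have 3: "\<epsilon>\<^sup>2 \<le> c * \<epsilon>\<^sup>2"
      using K by (simp add: c_def mult_le_cancel_right1)
    from 1 2 3 show ?thesis unfolding distrib_left by linarith
  qed
  have "\<phi> t \<le> \<phi> 0"
  proof (rule DERIV_nonpos_imp_decreasing_open[where f = \<phi>])
    show "0 \<le> t" using t by simp
    show "\<exists>y. (\<phi> has_real_derivative y) (at x) \<and> y \<le> 0" if "0 < x" "x < t" for x
      using d[of x] le[of x] that t
      by (intro exI[of _ "exp (- c * x) * (2 * (w x \<bullet> w' x) - c * (w x \<bullet> w x + \<epsilon>\<^sup>2))"])
         (auto simp: at_within_Icc_at mult_nonneg_nonpos)
    show "continuous_on {0..t} \<phi>"
      by (rule continuous_on_subset[of "{0..T}"])
         (use t in \<open>auto intro!: has_field_derivative_imp_has_derivative[THEN has_derivative_continuous] d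
            simp: continuous_on_eq_continuous_within\<close>)
  qed
  then have "exp (- c * t) * ((norm (w t))\<^sup>2 + \<epsilon>\<^sup>2) \<le> (norm (w 0))\<^sup>2 + \<epsilon>\<^sup>2"
    by (simp add: \<phi>_def dot_square_norm)
  then have "(norm (w t))\<^sup>2 + \<epsilon>\<^sup>2 \<le> ((norm (w 0))\<^sup>2 + \<epsilon>\<^sup>2) * exp (c * t)"
    by (simp add: exp_minus field_simps)
  then show ?thesis unfolding c_def by (smt (verit) zero_le_power2)
qed

text \<open>Negative times follow from the forward case by time reversal.\<close>

lemma gronwall:
  fixes w :: "real \<Rightarrow> 'a::real_inner"
  assumes K: "0 \<le> K"
    and deriv: "\<And>t. t \<in> {-T..T} \<Longrightarrow> (w has_vector_derivative w' t) (at t within {-T..T})"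
    and bound: "\<And>t. t \<in> {-T..T} \<Longrightarrow> norm (w' t) \<le> K * norm (w t) + \<epsilon>"
    and t: "t \<in> {-T..T}"
  shows "(norm (w t))\<^sup>2 \<le> ((norm (w 0))\<^sup>2 + \<epsilon>\<^sup>2) * exp ((2 * K + 1) * T)"
proof -
  have "(norm (w t))\<^sup>2 \<le> ((norm (w 0))\<^sup>2 + \<epsilon>\<^sup>2) * exp ((2 * K + 1) * \<bar>t\<bar>)"
  proof (cases "0 \<le> t")
    case True
    have "(norm (w t))\<^sup>2 \<le> ((norm (w 0))\<^sup>2 + \<epsilon>\<^sup>2) * exp ((2 * K + 1) * t)"
    proof (rule gronwall_forward[OF K])
      show "(w has_vector_derivative w' s) (at s within {0..T})" if "s \<in> {0..T}" for s
        using deriv[of s] that by (auto intro: has_vector_derivative_within_subset)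
    qed (use bound t True in auto)
    with True show ?thesis by simp
  next
    case False
    have "(norm (w (- (- t))))\<^sup>2 \<le> ((norm (w (- 0)))\<^sup>2 + \<epsilon>\<^sup>2) * exp ((2 * K + 1) * (- t))"
    proof (rule gronwall_forward[where w = "\<lambda>s. w (- s)", OF K])
      show "((\<lambda>s. w (- s)) has_vector_derivative - w' (- s)) (at s within {0..T})"
        if "s \<in> {0..T}" for s
      proof -
        have "(w has_vector_derivative w' (- s)) (at (- s) within uminus ` {0..T})"
          using deriv[of "- s"] that by (auto intro: has_vector_derivative_within_subset)
        moreover have "(uminus has_vector_derivative - 1) (at s within {0..T})"
          by (auto intro!: derivative_eq_intros)
        ultimately have "(w \<circ> uminus has_vector_derivative - 1 *\<^sub>R w' (- s)) (at s within {0..T})"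
          by (rule vector_diff_chain_within[rotated])
        then show ?thesis by (simp add: o_def)
      qed
    qed (use bound t False in auto)
    with False show ?thesis by simp
  qed
  also have "\<dots> \<le> ((norm (w 0))\<^sup>2 + \<epsilon>\<^sup>2) * exp ((2 * K + 1) * T)"
    using K t by (intro mult_left_mono) auto
  finally show ?thesis .
qed

section \<open>Existence of solutions\<close>

text \<open>The integral operator is a contraction on the Banach space of bounded continuous curves
  over the whole line; its fixed point solves the equation on \<open>{-T..T}\<close>.\<close>

lemma picard_lindelof:
  fixes g :: "'a::banach \<Rightarrow> 'a"
  assumes lip: "\<And>x y. norm (g x - g y) \<le> K * norm (x - y)" and K: "0 \<le> K"
    and T: "0 < T" "3 * T * K < 1"
  shows "\<exists>y. y 0 = x \<and> (\<forall>t\<in>{-T..T}. (y has_vector_derivative g (y t)) (at t within {-T..T}))"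
proof -
  \<comment> \<open>The oriented integral from 0 to \<open>t\<close>, in a form valid for both signs
    of \<open>t\<close>.\<close>
  define J where "J y t = integral {-T..t} (\<lambda>s. g (y s)) - integral {-T..0} (\<lambda>s. g (y s))"
    for y :: "real \<Rightarrow> 'a" and t
  \<comment> \<open>Clamping time to \<open>{-T..T}\<close> extends curves constantly beyond the
    interval and keeps them bounded.\<close>
  define cl where "cl t = max (-T) (min T t)" for t
  have cl: "cl t \<in> {-T..T}" for t using T by (auto simp: cl_def)
  have contg: "continuous_on UNIV g"
  proof (rule lipschitz_on_continuous_on)
    show "K-lipschitz_on UNIV g" using lip K by (auto intro!: lipschitz_onI simp: dist_norm)
  qed
  have contgy: "continuous_on S (\<lambda>s. g (apply_bcontfun y s))" for S and y :: "real \<Rightarrow>\<^sub>C 'a"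
    by (rule continuous_on_compose2[OF contg]) auto
  have dJ: "(J (apply_bcontfun y) has_vector_derivative g (y t)) (at t within {-T..T})"
    if "t \<in> {-T..T}" for y t
    unfolding J_def using integral_has_vector_derivative[OF contgy that, of y]
    by (auto intro!: derivative_eq_intros)
  have contJ: "continuous_on {-T..T} (J (apply_bcontfun y))" for y
    using dJ by (rule continuous_on_vector_derivative)
  have mem: "(\<lambda>t. x + J (apply_bcontfun y) (cl t)) \<in> bcontfun" for y
  proof -
    have "continuous_on UNIV (\<lambda>t. x + J (apply_bcontfun y) (cl t))"
      by (intro continuous_on_add continuous_on_const continuous_on_compose2[OF contJ])
         (use cl in \<open>auto simp: cl_def intro!: continuous_intros\<close>)
    moreover have "bounded (J (apply_bcontfun y) ` {-T..T})"
      by (intro compact_imp_bounded compact_continuous_image contJ) auto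
    then have "bounded ((+) x ` J (apply_bcontfun y) ` {-T..T})"
      by (rule bounded_translation)
    then have "bounded (range (\<lambda>t. x + J (apply_bcontfun y) (cl t)))"
      by (rule bounded_subset) (use cl in auto)
    ultimately show ?thesis by (simp add: bcontfun_def)
  qed
  define P where "P y = Bcontfun (\<lambda>t. x + J (apply_bcontfun y) (cl t))" for y
  have P: "apply_bcontfun (P y) t = x + J (apply_bcontfun y) (cl t)" for y t
    unfolding P_def by (simp add: Bcontfun_inverse[OF mem])
  \<comment> \<open>The two integrals in \<open>J\<close> run over lengths at most
    \<open>2 * T\<close> and \<open>T\<close>, which gives the factor 3.\<close>
  have "dist (P y) (P z) \<le> (3 * T * K) * dist y z" for y z
  proof (rule dist_bound)
    fix t
    let ?h = "\<lambda>s. g (apply_bcontfun y s) - g (apply_bcontfun z s)"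
    have int: "(\<lambda>s. g (apply_bcontfun u s)) integrable_on {a..b}"
      for u :: "real \<Rightarrow>\<^sub>C 'a" and a b
      by (rule integrable_continuous_real[OF contgy])
    have bnd: "norm (integral {-T..b} ?h) \<le> K * dist y z * (b - - T)" if "-T \<le> b" for b
    proof (rule integral_bound[OF that])
      show "continuous_on {-T..b} ?h" by (intro continuous_on_diff contgy)
      show "norm (?h s) \<le> K * dist y z" for s
      proof -
        have "norm (?h s) \<le> K * dist (y s) (z s)" using lip by (simp add: dist_norm)
        also have "\<dots> \<le> K * dist y z" by (intro mult_left_mono K dist_bounded)
        finally show "norm (?h s) \<le> K * dist y z" .
      qed
    qed
    have "dist (P y t) (P z t) = norm (integral {-T..cl t} ?h - integral {-T..0} ?h)"
      by (simp add: P J_def dist_norm integral_diff[OF int int] algebra_simps)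
    also have "\<dots> \<le> norm (integral {-T..cl t} ?h) + norm (integral {-T..0} ?h)"
      by (rule norm_triangle_ineq4)
    also have "\<dots> \<le> K * dist y z * (cl t - - T) + K * dist y z * (0 - - T)"
      using T cl[of t] by (intro add_mono bnd) auto
    also have "\<dots> = K * dist y z * (cl t + 2 * T)" by (simp add: algebra_simps)
    also have "\<dots> \<le> K * dist y z * (3 * T)"
      using cl[of t] K by (intro mult_left_mono) auto
    finally show "dist (P y t) (P z t) \<le> (3 * T * K) * dist y z" by (simp add: mult_ac)
  qed
  then obtain y where y: "P y = y"
    using banach_fix_type[of "3 * T * K" P] T K by auto
  have y_eq: "apply_bcontfun y t = x + J (apply_bcontfun y) (cl t)" for t
    using P[of y t] by (simp add: y)
  show ?thesis
  proof (intro exI conjI ballI)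
    show "apply_bcontfun y 0 = x"
      using T by (simp add: y_eq[of 0] cl_def J_def)
    fix t assume t: "t \<in> {-T..T}"
    have "((\<lambda>t. x + J (apply_bcontfun y) t) has_vector_derivative g (y t)) (at t within {-T..T})"
      using dJ[OF t, of y] by (auto intro!: derivative_eq_intros)
    moreover have "x + J (apply_bcontfun y) s = apply_bcontfun y s" if "s \<in> {-T..T}" for s
      using that by (simp add: y_eq[of s] cl_def)
    ultimately show "(apply_bcontfun y has_vector_derivative g (y t)) (at t within {-T..T})"
      using t by (metis (no_types, lifting) has_vector_derivative_transform)
  qed
qed

section \<open>Flows near an equilibrium\<close>

text \<open>The maximality clause of \<open>is_flow\<close> identifies solutions constructed by
  contraction with the flow.\<close>

lemma is_flow_unique_solution:
  assumes "is_flow X \<Omega> D \<Phi>" "x \<in> \<Omega>" "is_interval J" "0 \<in> J" "y 0 = x" "t \<in> J"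
    and "\<And>t. t \<in> J \<Longrightarrow> y t \<in> \<Omega>"
    and "\<And>t. t \<in> J \<Longrightarrow> (y has_vector_derivative X (y t)) (at t within J)"
  shows "\<Phi> t x = y t"
  using assms unfolding is_flow_def by blast

text \<open>Linearity in the initial value is uniqueness applied to sums and multiples of solutions;
  boundedness is Gronwall's inequality with zero error.\<close>

lemma linear_ode_solution_operator:
  fixes L :: "'a::{real_inner,banach} \<Rightarrow> 'a"
  assumes "linear L" and bound: "\<And>v. norm (L v) \<le> K * norm v" and K: "0 \<le> K"
    and T: "0 < T" "3 * T * K < 1"
  obtains Y where "\<And>v. Y v 0 = v"
    and "\<And>v t. t \<in> {-T..T} \<Longrightarrow> (Y v has_vector_derivative L (Y v t)) (at t within {-T..T})"
    and "\<And>t. t \<in> {-T..T} \<Longrightarrow> bounded_linear (\<lambda>v. Y v t)"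
proof -
  interpret linear L by fact
  have lip: "norm (L x - L y) \<le> K * norm (x - y)" for x y
    using bound[of "x - y"] by (simp add: diff)
  obtain Y where Y0: "\<And>v. Y v 0 = v"
    and dY: "\<And>v t. t \<in> {-T..T} \<Longrightarrow> (Y v has_vector_derivative L (Y v t)) (at t within {-T..T})"
    using picard_lindelof[of L K T, OF lip K T] by metis
  have unique: "w t = 0"
    if "w 0 = 0" "\<And>t. t \<in> {-T..T} \<Longrightarrow> (w has_vector_derivative L (w t)) (at t within {-T..T})"
      and "t \<in> {-T..T}" for w t
    using gronwall[of K T w "\<lambda>t. L (w t)" 0 t] K that bound by simp
  have "bounded_linear (\<lambda>v. Y v t)" if t: "t \<in> {-T..T}" for t
  proof (rule bounded_linear_intro)
    fix x y :: 'a and r :: real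
    have "Y (x + y) t - (Y x t + Y y t) = 0"
    proof (rule unique[OF _ _ t, of "\<lambda>t. Y (x + y) t - (Y x t + Y y t)"])
      show "((\<lambda>t. Y (x + y) t - (Y x t + Y y t)) has_vector_derivative
          L (Y (x + y) s - (Y x s + Y y s))) (at s within {-T..T})" if "s \<in> {-T..T}" for s
        unfolding diff add by (intro has_vector_derivative_diff has_vector_derivative_add dY that)
    qed (simp add: Y0)
    then show "Y (x + y) t = Y x t + Y y t" by simp
    have "Y (r *\<^sub>R x) t - r *\<^sub>R Y x t = 0"
    proof (rule unique[OF _ _ t, of "\<lambda>t. Y (r *\<^sub>R x) t - r *\<^sub>R Y x t"])
      show "((\<lambda>t. Y (r *\<^sub>R x) t - r *\<^sub>R Y x t) has_vector_derivative
          L (Y (r *\<^sub>R x) s - r *\<^sub>R Y x s)) (at s within {-T..T})" if "s \<in> {-T..T}" for s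
        unfolding diff scaleR using dY[OF that] by (auto intro!: derivative_eq_intros)
    qed (simp add: Y0)
    then show "Y (r *\<^sub>R x) t = r *\<^sub>R Y x t" by simp
    \<comment> \<open>The exponent is half of Gronwall's, which bounds the square of the
      norm.\<close>
    show "norm (Y x t) \<le> norm x * exp ((K + 1/2) * T)"
    proof (rule power2_le_imp_le)
      have "(norm (Y x t))\<^sup>2 \<le> ((norm (Y x 0))\<^sup>2 + 0\<^sup>2) * exp ((2 * K + 1) * T)"
        by (rule gronwall[OF K dY]) (use bound t in auto)
      also have "\<dots> = (norm x * exp ((K + 1/2) * T))\<^sup>2"
        by (simp add: Y0 power_mult_distrib algebra_simps flip: exp_double)
      finally show "(norm (Y x t))\<^sup>2 \<le> (norm x * exp ((K + 1/2) * T))\<^sup>2" .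
    qed auto
  qed
  with Y0 dY show ?thesis by (rule that)
qed

text \<open>The difference between a solution near \<open>xe\<close> and the linear solution with
  the same initial displacement satisfies the linear equation up to the remainder of
  \<open>X\<close> at \<open>xe\<close>. Solutions move away by at most a factor \<open>Q\<close>,
  so that remainder is small relative to the initial displacement, and Gronwall's inequality bounds
  the difference.\<close>

lemma flow_has_derivative_at_equilibrium:
  fixes X :: "real^'n \<Rightarrow> real^'n"
  assumes flow: "is_flow X \<Omega> D \<Phi>"
    and r: "0 < r" "cball xe r \<subseteq> \<Omega>" and K: "0 \<le> K"
    and lip: "\<And>x y. x \<in> cball xe r \<Longrightarrow> y \<in> cball xe r \<Longrightarrow> norm (X x - X y) \<le> K * norm (x - y)"
    and eq: "X xe = 0" and dX: "(X has_derivative L) (at xe)"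
    and K': "0 \<le> K'" "\<And>v. norm (L v) \<le> K' * norm v"
    and T: "0 < T" "3 * T * K < 1"
    and Y0: "\<And>v. Y v 0 = v"
    and dY: "\<And>v t. t \<in> {-T..T} \<Longrightarrow> (Y v has_vector_derivative L (Y v t)) (at t within {-T..T})"
    and linY: "\<And>t. t \<in> {-T..T} \<Longrightarrow> bounded_linear (\<lambda>v. Y v t)"
    and t: "t \<in> {-T..T}"
  shows "(\<Phi> t has_derivative (\<lambda>v. Y v t)) (at xe)"
proof -
  have linL: "linear L" using dX has_derivative_linear by blast
  let ?B = "cball xe r"
  \<comment> \<open>Outside the ball the field is replaced by its value at the nearest point, which makes it
    globally Lipschitz without changing solutions that stay in the ball.\<close>
  define g where "g x = X (closest_point ?B x)" for x
  have ne: "?B \<noteq> {}" using r by auto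
  have cp: "closest_point ?B x \<in> ?B" for x
    by (rule closest_point_in_set) (use ne in auto)
  have lipg: "norm (g x - g y) \<le> K * norm (x - y)" for x y
  proof -
    have "norm (g x - g y) \<le> K * norm (closest_point ?B x - closest_point ?B y)"
      unfolding g_def by (intro lip cp)
    also have "\<dots> \<le> K * norm (x - y)"
      using closest_point_lipschitz[of ?B x y] ne by (intro mult_left_mono K) (auto simp: dist_norm)
    finally show ?thesis .
  qed
  have g_in: "g x = X x" if "x \<in> ?B" for x
    using that by (simp add: g_def closest_point_self)
  obtain Z where Z0: "\<And>x. Z x 0 = x"
    and dZ: "\<And>x t. t \<in> {-T..T} \<Longrightarrow> (Z x has_vector_derivative g (Z x t)) (at t within {-T..T})"
    using picard_lindelof[of g K T, OF lipg K T] by metis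
  \<comment> \<open>Square roots of the Gronwall factors, for the Lipschitz constant
    \<open>K\<close> and for the linear bound \<open>K'\<close>.\<close>
  define Q where "Q = exp ((K + 1/2) * T)"
  define Q' where "Q' = exp ((K' + 1/2) * T)"
  have Q: "Q > 0" "Q' > 0" "exp ((2 * K + 1) * T) = Q\<^sup>2" "exp ((2 * K' + 1) * T) = Q'\<^sup>2"
    by (auto simp: Q_def Q'_def algebra_simps simp flip: exp_double)
  have gxe: "g xe = 0" using eq r by (simp add: g_in)
  have Zb: "norm (Z x s - xe) \<le> Q * norm (x - xe)" if s: "s \<in> {-T..T}" for x s
  proof (rule power2_le_imp_le)
    have "(norm (Z x s - xe))\<^sup>2 \<le> ((norm (Z x 0 - xe))\<^sup>2 + 0\<^sup>2) * exp ((2 * K + 1) * T)"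
    proof (rule gronwall[OF K _ _ s])
      show "((\<lambda>s. Z x s - xe) has_vector_derivative g (Z x u)) (at u within {-T..T})"
        if "u \<in> {-T..T}" for u
        using dZ[OF that] by (auto intro!: derivative_eq_intros)
      show "norm (g (Z x u)) \<le> K * norm (Z x u - xe) + 0" for u
        using lipg[of "Z x u" xe] by (simp add: gxe)
    qed
    also have "\<dots> = (Q * norm (x - xe))\<^sup>2" by (simp add: Z0 Q power_mult_distrib)
    finally show "(norm (Z x s - xe))\<^sup>2 \<le> (Q * norm (x - xe))\<^sup>2" .
  qed (use Q in auto)
  \<comment> \<open>Starting within \<open>r / Q\<close> the solution never leaves the ball, where
    \<open>g\<close> and \<open>X\<close> agree, so it solves the original equation.\<close>
  have Zin: "Z x s \<in> ?B" if "norm (x - xe) \<le> r / Q" "s \<in> {-T..T}" for x s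
  proof -
    have "Q * norm (x - xe) \<le> r" using that(1) Q by (simp add: field_simps)
    then show ?thesis using Zb[OF that(2), of x] by (simp add: dist_norm norm_minus_commute)
  qed
  have \<Phi>: "\<Phi> s x = Z x s" if x: "norm (x - xe) \<le> r / Q" and s: "s \<in> {-T..T}" for x s
  proof -
    have "x \<in> \<Omega>" using Zin[OF x, of 0] T r by (auto simp: Z0)
    then show ?thesis
    proof (rule is_flow_unique_solution[OF flow, of x "{-T..T}" "Z x" s])
      show "is_interval {-T..T}" by (rule is_interval_cc)
      show "Z x u \<in> \<Omega>" if "u \<in> {-T..T}" for u using Zin[OF x that] r by auto
      show "(Z x has_vector_derivative X (Z x u)) (at u within {-T..T})" if "u \<in> {-T..T}" for u
        using dZ[OF that, of x] g_in[OF Zin[OF x that]] by simp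
    qed (use T s Z0 in auto)
  qed
  have \<Phi>xe: "\<Phi> t xe = xe"
    using \<Phi>[of xe t] Zb[OF t, of xe] r Q t by simp
  show ?thesis
    unfolding has_derivative_at_alt
  proof (intro conjI allI impI linY[OF t])
    fix e :: real assume e: "0 < e"
    \<comment> \<open>\<open>Q\<close> compensates the growth of the solution, \<open>Q'\<close>
      that of the difference.\<close>
    define \<eta> where "\<eta> = e / (Q * Q')"
    have \<eta>: "0 < \<eta>" using e Q by (simp add: \<eta>_def)
    obtain \<delta> where \<delta>: "0 < \<delta>"
      "\<And>y. norm (y - xe) < \<delta> \<Longrightarrow> norm (X y - X xe - L (y - xe)) \<le> \<eta> * norm (y - xe)"
      using dX \<eta> unfolding has_derivative_at_alt by blast
    show "\<exists>d>0. \<forall>y. norm (y - xe) < d \<longrightarrow>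
        norm (\<Phi> t y - \<Phi> t xe - Y (y - xe) t) \<le> e * norm (y - xe)"
    proof (intro exI conjI allI impI)
      show "0 < min (r / Q) (\<delta> / Q)" using r \<delta> Q by simp
      fix x assume x: "norm (x - xe) < min (r / Q) (\<delta> / Q)"
      let ?w = "\<lambda>s. Z x s - xe - Y (x - xe) s"
      have "norm (?w t) \<le> e * norm (x - xe)"
      proof (rule power2_le_imp_le)
        have "(norm (?w t))\<^sup>2 \<le> ((norm (?w 0))\<^sup>2 + (\<eta> * Q * norm (x - xe))\<^sup>2) * exp ((2 * K' + 1) * T)"
        proof (rule gronwall[OF K'(1) _ _ t])
          show "(?w has_vector_derivative g (Z x s) - L (Y (x - xe) s)) (at s within {-T..T})"
            if "s \<in> {-T..T}" for s
            using dZ[OF that] dY[OF that] by (auto intro!: derivative_eq_intros)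
          show "norm (g (Z x s) - L (Y (x - xe) s)) \<le> K' * norm (?w s) + \<eta> * Q * norm (x - xe)"
            if s: "s \<in> {-T..T}" for s
          proof -
            have gX: "g (Z x s) = X (Z x s)" using Zin[OF _ s] x by (intro g_in) auto
            have "Q * norm (x - xe) < \<delta>" using x Q by (simp add: field_simps)
            then have "norm (Z x s - xe) < \<delta>" using Zb[OF s, of x] by simp
            from \<delta>(2)[OF this] have "norm (X (Z x s) - L (Z x s - xe)) \<le> \<eta> * norm (Z x s - xe)"
              by (simp add: eq)
            also have "\<dots> \<le> \<eta> * (Q * norm (x - xe))"
              using \<eta> by (intro mult_left_mono Zb s) auto
            finally have 1: "norm (X (Z x s) - L (Z x s - xe)) \<le> \<eta> * Q * norm (x - xe)"
              by simp
            have "g (Z x s) - L (Y (x - xe) s) = (X (Z x s) - L (Z x s - xe)) + L (?w s)"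
              by (simp add: gX linear_diff[OF linL])
            also have "norm \<dots> \<le> norm (X (Z x s) - L (Z x s - xe)) + norm (L (?w s))"
              by (rule norm_triangle_ineq)
            finally show ?thesis using 1 K'(2)[of "?w s"] by linarith
          qed
        qed
        also have "\<dots> = (\<eta> * Q * norm (x - xe))\<^sup>2 * Q'\<^sup>2"
          using Q by (simp add: Z0 Y0)
        also have "\<dots> = (e * norm (x - xe))\<^sup>2"
          using Q by (simp add: \<eta>_def power_mult_distrib power_divide)
        finally show "(norm (?w t))\<^sup>2 \<le> (e * norm (x - xe))\<^sup>2" .
      qed (use e in auto)
      then show "norm (\<Phi> t x - \<Phi> t xe - Y (x - xe) t) \<le> e * norm (x - xe)"
        using \<Phi>[OF _ t, of x] x by (simp add: \<Phi>xe)
    qed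
  qed
qed

text \<open>For small \<open>t\<close> the derivative of \<open>\<Phi> t\<close> at
  \<open>xe\<close> is the solution operator of the linear equation, whose time derivative at 0 is
  \<open>L\<close>.\<close>

lemma linearization_eq_derivative:
  fixes X :: "real^'n \<Rightarrow> real^'n"
  assumes flow: "is_flow X \<Omega> D \<Phi>"
    and r: "0 < r" "cball xe r \<subseteq> \<Omega>" and K: "0 \<le> K"
    and lip: "\<And>x y. x \<in> cball xe r \<Longrightarrow> y \<in> cball xe r \<Longrightarrow> norm (X x - X y) \<le> K * norm (x - y)"
    and eq: "X xe = 0" and dX: "(X has_derivative L) (at xe)"
  shows "linearization \<Phi> xe = L"
proof
  fix v
  have blL: "bounded_linear L" using dX by (rule has_derivative_bounded_linear)
  obtain K' where K': "0 \<le> K'" "\<And>v. norm (L v) \<le> K' * norm v"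
    using bounded_linear.nonneg_bounded[OF blL] by (metis mult.commute)
  \<comment> \<open>The denominator exceeds both \<open>3 * K\<close> and \<open>3 * K'\<close>, and
    stays positive when both constants vanish.\<close>
  define T where "T = 1 / (3 * (K + K') + 4)"
  have T: "0 < T" "3 * T * K < 1" "3 * T * K' < 1"
    using K K' by (auto simp: T_def field_simps)
  obtain Y where Y0: "\<And>v. Y v 0 = v"
    and dY: "\<And>v t. t \<in> {-T..T} \<Longrightarrow> (Y v has_vector_derivative L (Y v t)) (at t within {-T..T})"
    and linY: "\<And>t. t \<in> {-T..T} \<Longrightarrow> bounded_linear (\<lambda>v. Y v t)"
    using linear_ode_solution_operator[OF bounded_linear.linear[OF blL] K'(2,1) T(1,3)] by blast
  have fd: "Y v t = frechet_derivative (\<Phi> t) (at xe) v" if "t \<in> {-T<..<T}" for t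
  proof -
    have "(\<Phi> t has_derivative (\<lambda>v. Y v t)) (at xe)"
      using that by (intro flow_has_derivative_at_equilibrium[OF flow r K lip eq dX K' T(1,2) Y0 dY linY]) auto
    then show ?thesis by (metis frechet_derivative_at)
  qed
  have "(Y v has_vector_derivative L v) (at 0)"
    using dY[of 0 v] T by (simp add: Y0 at_within_Icc_at)
  then have "((\<lambda>t. frechet_derivative (\<Phi> t) (at xe) v) has_vector_derivative L v) (at 0)"
    by (rule has_vector_derivative_transform_within_open[of _ _ _ "{-T<..<T}"]) (use T fd in auto)
  then show "linearization \<Phi> xe v = L v"
    unfolding linearization_def by (rule vector_derivative_at)
qed

section \<open>Instability\<close>

text \<open>If the cubic relation holds, the space splits into the eigenspaces of \<open>L\<close> for \<open>\<mu>\<close>,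
  \<open>-\<mu>\<close> and 0; the squared component in the first one minus the other two squared components
  is a Chetaev function.\<close>

lemma not_lyap_stable_if_cubic:
  fixes X :: "real^'n \<Rightarrow> real^'n"
  assumes flow: "is_flow X \<Omega> D \<Phi>"
    and eq: "X xe = 0" and dX: "(X has_derivative L) (at xe)"
    and \<mu>: "0 < \<mu>" and cubic: "\<And>v. L (L (L v)) = \<mu>\<^sup>2 *\<^sub>R L v"
    and v0: "L v0 = \<mu> *\<^sub>R v0" "v0 \<noteq> 0"
  shows "\<not> lyap_stable D \<Phi> xe"
proof
  assume stable: "lyap_stable D \<Phi> xe"
  have blL: "bounded_linear L" using dX by (rule has_derivative_bounded_linear)
  note linL = bounded_linear.linear[OF blL]
  have blLL: "bounded_linear (\<lambda>v. L (L v))"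
    using bounded_linear_compose[OF blL blL] by simp
  \<comment> \<open>The spectral projections for \<open>\<mu>\<close>, \<open>- \<mu>\<close> and 0,
    as Lagrange interpolation polynomials in \<open>L\<close>.\<close>
  define Pp where "Pp v = (1 / (2 * \<mu>\<^sup>2)) *\<^sub>R (L (L v) + \<mu> *\<^sub>R L v)" for v
  define Pm where "Pm v = (1 / (2 * \<mu>\<^sup>2)) *\<^sub>R (L (L v) - \<mu> *\<^sub>R L v)" for v
  define P0 where "P0 v = v - (1 / \<mu>\<^sup>2) *\<^sub>R L (L v)" for v
  have bl: "bounded_linear Pp" "bounded_linear Pm" "bounded_linear P0"
    unfolding Pp_def[abs_def] Pm_def[abs_def] P0_def[abs_def]
    by (intro bounded_linear_const_scaleR bounded_linear_add bounded_linear_sub bounded_linear_ident blL blLL)+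
  have sum: "Pp v + Pm v + P0 v = v" for v
  proof -
    have "Pp v + Pm v = (1 / (2 * \<mu>\<^sup>2)) *\<^sub>R (2 *\<^sub>R L (L v))"
      unfolding Pp_def Pm_def scaleR_add_right[symmetric] by (simp add: scaleR_2)
    then show ?thesis by (simp add: P0_def)
  qed
  have PL: "Pp (L v) = \<mu> *\<^sub>R Pp v" "Pm (L v) = - \<mu> *\<^sub>R Pm v" "P0 (L v) = 0" for v
    using \<mu> by (simp_all add: Pp_def Pm_def P0_def cubic algebra_simps power2_eq_square)
  have Pv0: "Pp v0 = v0" "Pm v0 = 0" "P0 v0 = 0"
    using \<mu> by (simp_all add: Pp_def Pm_def P0_def v0 linear_scale[OF linL] algebra_simps power2_eq_square flip: scaleR_2)
  obtain B1 B2 B3 where B': "\<And>v. norm (Pp v) \<le> norm v * B1" "\<And>v. norm (Pm v) \<le> norm v * B2"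
    "\<And>v. norm (P0 v) \<le> norm v * B3" and pos: "0 < B1" "0 < B2" "0 < B3"
    using bl[THEN bounded_linear.pos_bounded] by auto
  define B where "B = max B1 (max B2 B3)"
  have B: "0 < B" using pos by (simp add: B_def)
  have PB: "norm (Pp v) \<le> B * norm v" "norm (Pm v) \<le> B * norm v" "norm (P0 v) \<le> B * norm v" for v
    using B'[of v] mult_left_mono[of B1 B "norm v"] mult_left_mono[of B2 B "norm v"] mult_left_mono[of B3 B "norm v"]
    by (auto simp: B_def mult.commute intro: order_trans)
  \<comment> \<open>With \<open>a\<close>, \<open>b\<close>, \<open>c\<close> the norms of the three
    components of \<open>z\<close>, the remainder then changes the growth of \<open>V\<close> by at
    most \<open>\<mu> / 3 * (a + b + c)\<^sup>2\<close>, hence by at most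
    \<open>\<mu> * (a\<^sup>2 + b\<^sup>2 + c\<^sup>2)\<close>.\<close>
  define \<eta> where "\<eta> = \<mu> / (6 * B)"
  have \<eta>: "0 < \<eta>" using \<mu> B by (simp add: \<eta>_def)
  obtain \<epsilon> where \<epsilon>: "0 < \<epsilon>"
    "\<And>y. norm (y - xe) < \<epsilon> \<Longrightarrow> norm (X y - X xe - L (y - xe)) \<le> \<eta> * norm (y - xe)"
    using dX \<eta> unfolding has_derivative_at_alt by blast
  \<comment> \<open>\<open>W z u\<close> is the derivative of the Chetaev function \<open>V\<close>
    at \<open>z\<close> in direction \<open>u\<close>.\<close>
  define W where "W z u = 2 * (Pp z \<bullet> Pp u) - 2 * (Pm z \<bullet> Pm u) - 2 * (P0 z \<bullet> P0 u)" for z u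
  define V where "V z = Pp z \<bullet> Pp z - Pm z \<bullet> Pm z - P0 z \<bullet> P0 z" for z
  have growth: "\<mu> * V z \<le> W z (X (xe + z))" if "norm z < \<epsilon>" for z
  proof -
    define R where "R = X (xe + z) - L z"
    define a where "a = norm (Pp z)"
    define b where "b = norm (Pm z)"
    define c where "c = norm (P0 z)"
    define k where "k = \<mu> / 6 * (a + b + c)"
    have "norm R \<le> \<eta> * norm z" using \<epsilon>(2)[of "xe + z"] that by (simp add: R_def eq)
    moreover have "norm z \<le> a + b + c"
      using norm_triangle_ineq[of "Pp z + Pm z" "P0 z"] norm_triangle_ineq[of "Pp z" "Pm z"]
      by (simp add: sum a_def b_def c_def)
    ultimately have "norm R \<le> \<eta> * (a + b + c)"
      using \<eta> by (smt (verit) mult_left_mono)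
    then have "B * norm R \<le> B * (\<eta> * (a + b + c))" using B by simp
    also have "\<dots> = \<mu> / 6 * (a + b + c)" using B by (simp add: \<eta>_def)
    finally have BR: "B * norm R \<le> k" by (simp add: k_def)
    have inner: "\<bar>x \<bullet> y\<bar> \<le> norm x * k" if "norm y \<le> B * norm R" for x y :: "real^'n"
      using Cauchy_Schwarz_ineq2[of x y] mult_left_mono[OF order_trans[OF that BR], of "norm x"] by simp
    have Xz: "X (xe + z) = L z + R" by (simp add: R_def)
    have "W z (X (xe + z)) = 2 * \<mu> * a\<^sup>2 + 2 * \<mu> * b\<^sup>2
        + 2 * (Pp z \<bullet> Pp R - Pm z \<bullet> Pm R - P0 z \<bullet> P0 R)"
      unfolding Xz W_def bl[THEN bounded_linear.linear, THEN linear_add] PL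
      by (simp add: inner_add_right a_def b_def dot_square_norm algebra_simps)
    moreover have "\<bar>Pp z \<bullet> Pp R\<bar> \<le> a * k"
      "\<bar>Pm z \<bullet> Pm R\<bar> \<le> b * k" "\<bar>P0 z \<bullet> P0 R\<bar> \<le> c * k"
      unfolding a_def b_def c_def by (intro inner PB)+
    moreover have "2 * ((a + b + c) * k) \<le> \<mu> * (a\<^sup>2 + b\<^sup>2 + c\<^sup>2)"
    proof -
      have "(a + b + c)\<^sup>2 \<le> 3 * (a\<^sup>2 + b\<^sup>2 + c\<^sup>2)"
        using sum_squares_ge_zero[of "a - b" "b - c"] zero_le_square[of "a - c"]
        by (simp add: power2_eq_square algebra_simps)
      then have "\<mu> / 3 * (a + b + c)\<^sup>2 \<le> \<mu> / 3 * (3 * (a\<^sup>2 + b\<^sup>2 + c\<^sup>2))"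
        using \<mu> by (intro mult_left_mono) auto
      then show ?thesis by (simp add: k_def power2_eq_square algebra_simps)
    qed
    moreover have "(a + b + c) * k
        = a * k + b * k + c * k"
      by (simp only: distrib_right)
    \<comment> \<open>This lower bound exceeds \<open>\<mu> * V z\<close> by
      \<open>2 * \<mu> * b\<^sup>2\<close>.\<close>
    ultimately have "W z (X (xe + z)) \<ge> 2 * \<mu> * a\<^sup>2 + 2 * \<mu> * b\<^sup>2 - \<mu> * (a\<^sup>2 + b\<^sup>2 + c\<^sup>2)"
      by (smt (verit))
    moreover have V: "V z = a\<^sup>2 - b\<^sup>2 - c\<^sup>2" by (simp add: V_def a_def b_def c_def dot_square_norm)
    moreover have "0 \<le> \<mu> * b\<^sup>2" using \<mu> by simp
    ultimately show ?thesis unfolding V by (simp add: algebra_simps)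
  qed
  obtain \<delta> where \<delta>: "0 < \<delta>"
    "\<And>x t. dist x xe < \<delta> \<Longrightarrow> 0 \<le> t \<Longrightarrow> (t, x) \<in> D \<and> dist (\<Phi> t x) xe < \<epsilon>"
    using stable \<epsilon>(1) unfolding lyap_stable_def by metis
  \<comment> \<open>The solution starts at distance \<open>\<delta> / 2\<close> from
    \<open>xe\<close> along the unstable eigenvector, where \<open>V\<close> is positive.\<close>
  define s where "s = \<delta> / (2 * norm v0)"
  have s: "0 < s" using \<delta> v0 by (simp add: s_def)
  define x where "x = xe + s *\<^sub>R v0"
  have "dist x xe = \<delta> / 2" using v0 \<delta> by (simp add: x_def dist_norm s_def)
  then have x: "(t, x) \<in> D \<and> dist (\<Phi> t x) xe < \<epsilon>" if "0 \<le> t" for t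
    using \<delta> that by simp
  define z where "z t = \<Phi> t x - xe" for t
  have z: "norm (z t) < \<epsilon>" if "0 \<le> t" for t using x[OF that] by (simp add: z_def dist_norm)
  \<comment> \<open>Stability makes the solution exist for all nonnegative times. This gives a
    two-sided derivative at positive times; at 0 the continuity shown next is enough.\<close>
  have dz: "(z has_vector_derivative X (xe + z t)) (at t)" if "0 < t" for t
  proof -
    have "((\<lambda>s. \<Phi> s x) has_vector_derivative X (\<Phi> t x)) (at t within {s. (s, x) \<in> D})"
      using flow x[of t] that unfolding is_flow_def by auto
    then have "((\<lambda>s. \<Phi> s x) has_vector_derivative X (\<Phi> t x)) (at t within {0<..})"
      by (rule has_vector_derivative_within_subset) (use x in auto)
    then have "((\<lambda>s. \<Phi> s x) has_vector_derivative X (\<Phi> t x)) (at t)"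
      using that at_within_open[of t "{0<..}"] by simp
    then show ?thesis unfolding z_def by (auto intro!: derivative_eq_intros)
  qed
  have contz: "continuous_on {0..} z"
    unfolding continuous_on_eq_continuous_within
  proof
    fix t :: real assume t: "t \<in> {0..}"
    have "((\<lambda>s. \<Phi> s x) has_vector_derivative X (\<Phi> t x)) (at t within {s. (s, x) \<in> D})"
      using flow x[of t] t unfolding is_flow_def by auto
    then have "((\<lambda>s. \<Phi> s x) has_vector_derivative X (\<Phi> t x)) (at t within {0..})"
      by (rule has_vector_derivative_within_subset) (use x in auto)
    then show "continuous (at t within {0..}) z"
      unfolding z_def by (intro continuous_diff continuous_const has_vector_derivative_continuous)
  qed
  have "x \<in> \<Omega>" using flow x[of 0] unfolding is_flow_def by auto
  then have z0: "z 0 = s *\<^sub>R v0" using flow unfolding is_flow_def by (simp add: z_def x_def)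
  have Vz0: "V (z 0) = s\<^sup>2 * (norm v0)\<^sup>2"
    unfolding z0 V_def bl[THEN bounded_linear.linear, THEN linear_scale] Pv0
    by (simp add: dot_square_norm power2_eq_square)
  \<comment> \<open>By \<open>growth\<close> this is nondecreasing, so \<open>V\<close> grows at
    least like \<open>exp (\<mu> * t)\<close>.\<close>
  define \<psi> where "\<psi> t = exp (- \<mu> * t) * V (z t)" for t
  have d\<psi>: "(\<psi> has_real_derivative exp (- \<mu> * t) * (W (z t) (X (xe + z t)) - \<mu> * V (z t))) (at t)"
    if "0 < t" for t
  proof -
    note d = dz[OF that, unfolded has_vector_derivative_def]
    note dP = bl[THEN bounded_linear.has_derivative, OF d]
    show ?thesis
      unfolding \<psi>_def V_def has_field_derivative_def
      by (rule derivative_eq_intros dP refl | simp)+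
         (auto simp: fun_eq_iff W_def algebra_simps inner_commute bl[THEN bounded_linear.linear, THEN linear_scale])
  qed
  have low: "V (z 0) * exp (\<mu> * t) \<le> V (z t)" if "0 < t" for t
  proof -
    have "\<psi> 0 \<le> \<psi> t"
    proof (rule DERIV_nonneg_imp_increasing_open[where f = \<psi>])
      show "0 \<le> t" using that by simp
      show "\<exists>y. (\<psi> has_real_derivative y) (at u) \<and> 0 \<le> y" if "0 < u" "u < t" for u
        using d\<psi>[OF that(1)] growth[OF z[of u]] that
        by (intro exI[of _ "exp (- \<mu> * u) * (W (z u) (X (xe + z u)) - \<mu> * V (z u))"]) auto
      have cz: "continuous_on {0..t} z" by (rule continuous_on_subset[OF contz]) auto
      show "continuous_on {0..t} \<psi>"
        unfolding \<psi>_def V_def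
        by (intro continuous_intros bl[THEN linear_continuous_on_compose[OF cz bounded_linear.linear]])
    qed
    then show ?thesis by (simp add: \<psi>_def exp_minus field_simps)
  qed
  have up: "V (z t) \<le> (B * \<epsilon>)\<^sup>2" if "0 < t" for t
  proof -
    have "norm (Pp (z t)) \<le> B * \<epsilon>"
      using PB(1)[of "z t"] z[of t] that B by (smt (verit) mult_left_mono)
    then have "(norm (Pp (z t)))\<^sup>2 \<le> (B * \<epsilon>)\<^sup>2" by (intro power_mono) auto
    then show ?thesis by (simp add: V_def dot_square_norm) (smt (verit) zero_le_power2)
  qed
  define c where "c = V (z 0)"
  have c: "0 < c" using s v0 by (simp add: c_def Vz0)
  \<comment> \<open>At this time \<open>c * (\<mu> * t)\<close> equals the upper bound for
    \<open>V\<close>, and the exponential lower bound is strictly larger.\<close>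
  define t where "t = (B * \<epsilon>)\<^sup>2 / (c * \<mu>)"
  have t: "0 < t" using B \<epsilon> c \<mu> by (simp add: t_def)
  have "(B * \<epsilon>)\<^sup>2 = c * (\<mu> * t)" using c \<mu> by (simp add: t_def)
  also have "\<dots> < c * exp (\<mu> * t)"
    using c exp_ge_add_one_self[of "\<mu> * t"] by (intro mult_strict_left_mono) linarith+
  finally show False using low[OF t] up[OF t] by (simp add: c_def)
qed

section \<open>The Hamiltonian field at a regular equilibrium\<close>

text \<open>The last two positions carry the rows of the coordinate function and of \<open>H\<close>
  in the Jacobian; \<open>f\<close> lists the other indices in the order used by
  \<open>wedge\<close> and \<open>IX\<close>.\<close>

lemma coord_pos_last_two:
  assumes "CARD('n::{finite,linorder}) \<ge> 2"
  obtains p q :: "'n::{finite,linorder}" and f :: "nat \<Rightarrow> 'n"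
  where "coord_pos p = CARD('n) - 2" "coord_pos q = CARD('n) - 1"
    "bij_betw f {..<CARD('n) - 2} (UNIV - {p, q})"
    "\<And>a. a < CARD('n) - 2 \<Longrightarrow> coord_pos (f a) = a"
proof -
  let ?g = "inv_into (UNIV :: 'n set) coord_pos"
  have bij: "bij_betw ?g {..<CARD('n)} UNIV"
    by (rule bij_betw_inv_into[OF bij_betw_coord_pos])
  have pos: "coord_pos (?g a) = a" if "a < CARD('n)" for a
    using bij_betw_coord_pos[where 'n = 'n] that
    by (metis bij_betw_inv_into_right lessThan_iff)
  have "{..<CARD('n)} - {CARD('n) - 2, CARD('n) - 1} = {..<CARD('n) - 2}"
    using assms by auto
  moreover have "bij_betw ?g ({..<CARD('n)} - {CARD('n) - 2, CARD('n) - 1})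
      (UNIV - {?g (CARD('n) - 2), ?g (CARD('n) - 1)})"
  proof -
    have "?g ` ({..<CARD('n)} - {CARD('n) - 2, CARD('n) - 1})
        = ?g ` {..<CARD('n)} - ?g ` {CARD('n) - 2, CARD('n) - 1}"
      using bij assms by (intro inj_on_image_set_diff[where C = "{..<CARD('n)}"]) (auto simp: bij_betw_def)
    then show ?thesis
      using bij by (auto simp: bij_betw_def intro: inj_on_subset)
  qed
  ultimately show ?thesis
    using assms pos by (intro that[of "?g (CARD('n) - 2)" "?g (CARD('n) - 1)" ?g]) auto
qed

text \<open>The gradient of the coordinate function is a unit vector. List positions count from 0
  and the \<open>C i\<close> from 1, hence \<open>coord_pos r + 1\<close>.\<close>

lemma hfield_eq_det_with_rows:
  fixes x :: "real^('n::{finite,linorder})" and p q :: "'n::{finite,linorder}"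
  assumes n: "CARD('n) \<ge> 2"
    and p: "coord_pos p = CARD('n) - 2" and q: "coord_pos q = CARD('n) - 1"
    and lt: "\<And>r. r \<noteq> p \<Longrightarrow> r \<noteq> q \<Longrightarrow> coord_pos r < CARD('n) - 2"
  shows "hfield \<nu> C x $ i = \<nu> x *
    det_with_rows p q (\<lambda>r. grad (C (coord_pos r + 1)) x) (axis i 1) (grad (C (CARD('n) - 1)) x)"
proof -
  let ?fs = "map C [1..<CARD('n) - 1] @ [(\<lambda>y. y $ i), C (CARD('n) - 1)]"
  have "p \<noteq> q" using p q n by auto
  have row: "grad (?fs ! coord_pos r) x = (if r = p then axis i 1 else if r = q then grad (C (CARD('n) - 1)) x
      else grad (C (coord_pos r + 1)) x)" for r
  proof -
    have 1: "CARD('n) - Suc (CARD('n) - 2) = 1" "CARD('n) - Suc 0 - (CARD('n) - 2) = 1"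
      using n by auto
    show ?thesis
      using \<open>p \<noteq> q\<close> n lt[of r] by (auto simp: nth_append p q grad_coordinate 1)
  qed
  show ?thesis
    by (simp only: hfield_def jac_det_def det_with_rows_def vec_lambda_beta vec_lambda_eta row)
qed

theorem theorem5p4:
  fixes \<Omega> :: "(real^('n::{finite,linorder})) set"
    and \<nu> :: "real^('n::{finite,linorder}) \<Rightarrow> real"
    and C :: "nat \<Rightarrow> real^('n::{finite,linorder}) \<Rightarrow> real"
    and lam :: "nat \<Rightarrow> real"
    and xe :: "real^('n::{finite,linorder})"
    and D :: "(real \<times> (real^('n::{finite,linorder}))) set"
    and \<Phi> :: "real \<Rightarrow> real^('n::{finite,linorder}) \<Rightarrow> real^('n::{finite,linorder})"
  assumes "CARD('n) \<ge> 2"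
    and "open \<Omega>"
    and "smooth_on \<Omega> \<nu>"
    and "\<forall>i\<in>{1..CARD('n) - 1}. smooth_on \<Omega> (C i)"
    and "xe \<in> regular_equilibria \<Omega> \<nu> C"
    and "grad (C (CARD('n) - 1)) xe + (\<Sum>i=1..CARD('n) - 2. lam i *\<^sub>R grad (C i) xe) = 0"
    and "invertible (hess (lagrange_F C lam) xe)"
    and "is_flow (hfield \<nu> C) \<Omega> D \<Phi>"
  shows "(\<forall>\<mu>::real. det (matrix (linearization \<Phi> xe) - \<mu> *\<^sub>R mat 1)
            = (- \<mu>) ^ (CARD('n) - 2) * (\<mu>\<^sup>2 + IX \<nu> C lam xe))
       \<and> (IX \<nu> C lam xe < 0 \<longrightarrow> \<not> lyap_stable D \<Phi> xe)"
proof -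
  note n = assms(1) and \<Omega> = assms(2) and flow = assms(8)
  obtain p q :: 'n and f where p: "coord_pos p = CARD('n) - 2" and q: "coord_pos q = CARD('n) - 1"
    and f: "bij_betw f {..<CARD('n) - 2} (UNIV - {p, q})"
    and pos_f: "\<And>a. a < CARD('n) - 2 \<Longrightarrow> coord_pos (f a) = a"
    using coord_pos_last_two[OF n] by blast
  have pq: "p \<noteq> q" using p q n by auto
  have lt: "coord_pos r < CARD('n) - 2" if "r \<noteq> p" "r \<noteq> q" for r
  proof -
    have "r \<in> f ` {..<CARD('n) - 2}" using f that by (auto simp: bij_betw_def)
    then show ?thesis using pos_f by auto
  qed
  have fpq: "f a \<noteq> p \<and> f a \<noteq> q" if "a < CARD('n) - 2" for a
    using f that by (auto simp: bij_betw_def)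
  have CkC: "Ck_on k \<Omega> (C i)" if "i \<in> {1..CARD('n) - 1}" for k i
    using assms(4) that by (simp add: smooth_on_def)
  have Ck\<nu>: "Ck_on k \<Omega> \<nu>" for k using assms(3) by (simp add: smooth_on_def)
  have xe: "xe \<in> \<Omega>" and wedge: "wedge (CARD('n) - 2) (\<lambda>a. grad (C (a + 1)) xe) \<noteq> (\<lambda>_. 0)"
    using assms(5) by (auto simp: regular_equilibria_def)
  define X where "X = hfield \<nu> C"
  define F where "F = lagrange_F C lam"
  define A where "A = hess F xe"
  define c where "c x r = grad (C (coord_pos r + 1)) x" for x and r :: 'n
  have CkF: "Ck_on k \<Omega> F" for k
    unfolding F_def lagrange_F_def[abs_def]
    by (intro Ck_on_add_sum CkC) (use n in auto)
  have gradF: "grad F x = grad (C (CARD('n) - 1)) x + (\<Sum>i=1..CARD('n) - 2. lam i *\<^sub>R grad (C i) x)"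
    if "x \<in> \<Omega>" for x
  proof (rule grad_eqI)
    have d: "(C i has_derivative (\<lambda>v. grad (C i) x \<bullet> v)) (at x)" if "i \<in> {1..CARD('n) - 1}" for i
      by (rule has_derivative_grad[OF Ck_on_Suc_imp_differentiable[OF CkC[OF that, of 1, unfolded One_nat_def] \<open>x \<in> \<Omega>\<close>]])
    have "((\<lambda>y. C (CARD('n) - 1) y + (\<Sum>i=1..CARD('n) - 2. lam i * C i y)) has_derivative
        (\<lambda>v. grad (C (CARD('n) - 1)) x \<bullet> v + (\<Sum>i=1..CARD('n) - 2. lam i * (grad (C i) x \<bullet> v)))) (at x)"
      by (intro has_derivative_add has_derivative_sum has_derivative_mult_right d) (use n in auto)
    then show "(F has_derivative (\<lambda>v. (grad (C (CARD('n) - 1)) x + (\<Sum>i=1..CARD('n) - 2. lam i *\<^sub>R grad (C i) x)) \<bullet> v)) (at x)"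
      by (simp add: F_def lagrange_F_def[abs_def] inner_add_left inner_sum_left)
  qed
  have gradFxe: "grad F xe = 0" using gradF[OF xe] assms(6) by simp
  have X_H: "X x $ i = \<nu> x * det_with_rows p q (c x) (axis i 1) (grad (C (CARD('n) - 1)) x)" for x i
    unfolding X_def c_def by (rule hfield_eq_det_with_rows[OF n p q lt])
  \<comment> \<open>The form annihilates the gradients of the first n-2 functions, so
    \<open>grad F\<close> may replace that of \<open>H\<close>. Expanding it in unit vectors
    displays \<open>X\<close> as a combination of components of \<open>grad F\<close>, each of which
    vanishes at \<open>xe\<close>.\<close>
  have X_F: "X x $ i = (\<Sum>k\<in>UNIV. (\<nu> x * det_with_rows p q (c x) (axis i 1) (axis k 1)) * grad F x $ k)"
    if x: "x \<in> \<Omega>" for x i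
  proof -
    interpret W: linear "det_with_rows p q (c x) (axis i 1)"
      by (rule det_with_rows_linear_last[OF pq])
    have zero: "det_with_rows p q (c x) (axis i 1) (grad (C j) x) = 0" if "j \<in> {1..CARD('n) - 2}" for j
    proof -
      have "j - 1 < CARD('n) - 2" using that by auto
      then have "c x (f (j - 1)) = grad (C j) x" and "f (j - 1) \<noteq> p" "f (j - 1) \<noteq> q"
        using pos_f[of "j - 1"] fpq[of "j - 1"] that by (auto simp: c_def)
      then show ?thesis using det_with_rows_eq_0[OF pq, of "f (j - 1)" "c x"] by simp
    qed
    have "det_with_rows p q (c x) (axis i 1) (grad F x)
        = det_with_rows p q (c x) (axis i 1) (grad (C (CARD('n) - 1)) x)"
      unfolding gradF[OF x] by (simp add: W.add W.sum W.scaleR zero)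
    moreover have "det_with_rows p q (c x) (axis i 1) (grad F x)
        = (\<Sum>k\<in>UNIV. grad F x $ k * det_with_rows p q (c x) (axis i 1) (axis k 1))"
    proof -
      have "det_with_rows p q (c x) (axis i 1) (grad F x)
          = det_with_rows p q (c x) (axis i 1) (\<Sum>k\<in>UNIV. grad F x $ k *s axis k 1)"
        by (simp add: basis_expansion)
      also have "\<dots> = (\<Sum>k\<in>UNIV. grad F x $ k * det_with_rows p q (c x) (axis i 1) (axis k 1))"
        by (simp add: W.sum scalar_mult_eq_scaleR W.scaleR)
      finally show ?thesis .
    qed
    ultimately have "X x $ i = \<nu> x * (\<Sum>k\<in>UNIV. grad F x $ k * det_with_rows p q (c x) (axis i 1) (axis k 1))"
      by (simp add: X_H)
    then show ?thesis by (simp add: sum_distrib_left mult_ac)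
  qed
  obtain r where r: "0 < r" "cball xe r \<subseteq> \<Omega>" using \<Omega> xe open_contains_cball by blast
  have lip_grad: "bdd_lipschitz_on (cball xe r) (\<lambda>x. grad (C i) x $ s)" if "i \<in> {1..CARD('n) - 1}" for i s
    by (intro Ck_on_imp_bdd_lipschitz_on_cball[OF \<Omega> r(2)] Ck_on_grad[OF \<Omega>] CkC that)
  have lip_\<nu>: "bdd_lipschitz_on (cball xe r) \<nu>"
    by (intro Ck_on_imp_bdd_lipschitz_on_cball[OF \<Omega> r(2)] Ck\<nu>)
  have lip_W: "bdd_lipschitz_on (cball xe r) (\<lambda>x. det_with_rows p q (c x) (axis i 1) (z x))"
    if "\<And>s. bdd_lipschitz_on (cball xe r) (\<lambda>x. z x $ s)" for i z
    unfolding det_with_rows_def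
  proof (rule bdd_lipschitz_on_det)
    fix k s
    have "bdd_lipschitz_on (cball xe r) (\<lambda>x. c x k $ s)" if "k \<noteq> p" "k \<noteq> q"
      unfolding c_def by (rule lip_grad) (use lt[OF that] in auto)
    then show "bdd_lipschitz_on (cball xe r) (\<lambda>x. (\<chi> r. if r = p then axis i 1 else if r = q then z x else c x r) $ k $ s)"
      using that by (cases "k = p"; cases "k = q") (auto intro: bdd_lipschitz_on_const)
  qed
  have "bdd_lipschitz_on (cball xe r) (\<lambda>x. X x $ i)" for i
    unfolding X_H by (intro bdd_lipschitz_on_mult lip_\<nu> lip_W lip_grad) (use n in auto)
  then obtain K where K: "0 \<le> K"
    "\<And>x y. x \<in> cball xe r \<Longrightarrow> y \<in> cball xe r \<Longrightarrow> norm (X x - X y) \<le> K * norm (x - y)"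
    using bdd_lipschitz_on_vec by metis
  \<comment> \<open>The candidate for the derivative of \<open>X\<close>: as \<open>grad F\<close>
    vanishes at \<open>xe\<close>, only this factor is differentiated, with derivative
    \<open>A\<close>.\<close>
  define L where
    "L = (\<chi> i j :: 'n. \<nu> xe * det_with_rows p q (c xe) (axis i 1) (A *v axis j 1))"
  have L: "(L *v v) $ i = \<nu> xe * det_with_rows p q (c xe) (axis i 1) (A *v v)" for v i
  proof -
    interpret W: linear "\<lambda>v. \<nu> xe * det_with_rows p q (c xe) (axis i 1) (A *v v)"
      using det_with_rows_linear_last[OF pq, of "c xe" "axis i 1"]
      by (intro linearI)
         (simp_all add: matrix_vector_right_distrib matrix_vector_mult_scaleR linear_add linear_scale distrib_left)
    have "\<nu> xe * det_with_rows p q (c xe) (axis i 1) (A *v v)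
        = \<nu> xe * det_with_rows p q (c xe) (axis i 1) (A *v (\<Sum>j\<in>UNIV. v $ j *s axis j 1))"
      by (simp add: basis_expansion)
    also have "\<dots> = (\<Sum>j\<in>UNIV. v $ j * (\<nu> xe * det_with_rows p q (c xe) (axis i 1) (A *v axis j 1)))"
      unfolding W.sum by (intro sum.cong refl) (metis W.scaleR real_scaleR_def scalar_mult_eq_scaleR)
    finally show ?thesis by (simp add: L_def matrix_vector_mult_def mult.commute)
  qed
  \<comment> \<open>Since \<open>grad F\<close> vanishes at \<open>xe\<close>, continuity of its coefficients in \<open>X\<close> is enough.\<close>
  have "((\<lambda>x. X x $ i) has_derivative (\<lambda>v. (L *v v) $ i)) (at xe)" for i
  proof -
    let ?k = "\<lambda>k x. \<nu> x * det_with_rows p q (c x) (axis i 1) (axis k 1)"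
    have "isCont (?k k) xe" for k
      by (rule bdd_lipschitz_on_cball_imp_isCont[OF _ r(1)])
         (intro bdd_lipschitz_on_mult lip_\<nu> lip_W bdd_lipschitz_on_const)
    then have "((\<lambda>x. ?k k x * grad F x $ k) has_derivative (\<lambda>v. ?k k xe * (A *v v) $ k)) (at xe)" for k
      unfolding A_def by (rule has_derivative_mult_vanishing[OF _ has_derivative_grad_nth[OF \<Omega> CkF xe]]) (simp add: gradFxe)
    then have "((\<lambda>x. \<Sum>k\<in>UNIV. ?k k x * grad F x $ k) has_derivative
        (\<lambda>v. \<Sum>k\<in>UNIV. ?k k xe * (A *v v) $ k)) (at xe)"
      by (intro has_derivative_sum)
    moreover have "(\<Sum>k\<in>UNIV. ?k k xe * (A *v v) $ k) = (L *v v) $ i" for v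
    proof -
      interpret W: linear "det_with_rows p q (c xe) (axis i 1)"
        by (rule det_with_rows_linear_last[OF pq])
      have "(L *v v) $ i = \<nu> xe * det_with_rows p q (c xe) (axis i 1) (\<Sum>k\<in>UNIV. (A *v v) $ k *s axis k 1)"
        unfolding L by (simp only: basis_expansion)
      also have "\<dots> = (\<Sum>k\<in>UNIV. ?k k xe * (A *v v) $ k)"
        by (simp add: W.sum scalar_mult_eq_scaleR W.scaleR sum_distrib_left mult_ac)
      finally show ?thesis by simp
    qed
    ultimately have "((\<lambda>x. \<Sum>k\<in>UNIV. ?k k x * grad F x $ k) has_derivative (\<lambda>v. (L *v v) $ i)) (at xe)"
      by simp
    then show ?thesis
      by (rule has_derivative_transform_within_open[OF _ \<Omega> xe]) (simp add: X_F)
  qed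
  then have dX: "(X has_derivative (\<lambda>v. L *v v)) (at xe)"
    unfolding has_derivative_componentwise_within[of X] Basis_vec_def by (auto simp: inner_axis)
  have Xxe: "X xe = 0" by (simp add: vec_eq_iff X_F[OF xe] gradFxe)
  have lin: "linearization \<Phi> xe = (\<lambda>v. L *v v)"
    by (rule linearization_eq_derivative[OF flow[folded X_def] r K(1,2) Xxe dX])
  \<comment> \<open>Regularity of the equilibrium enters here: the n-2 gradients are independent and
    can be completed to a basis.\<close>
  obtain a b where basis: "det_with_rows p q (c xe) a b \<noteq> 0"
    using wedge_nonzero_imp_det_with_rows_nonzero[OF wedge n p q f pos_f] by (auto simp: c_def[abs_def])
  have sym: "transpose A = A"
    using hess_symmetric[OF \<Omega> CkF xe] by (simp add: A_def transpose_def vec_eq_iff)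
  have inv: "invertible A" using assms(7) by (simp add: A_def F_def)
  have I: "IX \<nu> C lam xe = (\<nu> xe)\<^sup>2 * det A *
      det_nat (CARD('n) - 2) (\<lambda>a b. (matrix_inv A *v c xe (f a)) \<bullet> c xe (f b))"
    unfolding IX_def Let_def A_def[symmetric] F_def[symmetric]
    by (intro arg_cong2[where f="(*)"] det_nat_cong refl) (simp add: c_def pos_f)
  note spectrum = linear_field_spectrum[OF pq sym inv basis L f I]
  have "\<not> lyap_stable D \<Phi> xe" if neg: "IX \<nu> C lam xe < 0"
  proof -
    define \<mu> where "\<mu> = sqrt (- IX \<nu> C lam xe)"
    have \<mu>: "0 < \<mu>" "\<mu>\<^sup>2 = - IX \<nu> C lam xe" using neg by (auto simp: \<mu>_def)
    \<comment> \<open>\<open>\<mu>\<close> is a root of the quadratic factor of the characteristic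
      polynomial; an eigenvector for it supplies the unstable direction.\<close>
    have "det (L - \<mu> *\<^sub>R mat 1) = 0" by (simp add: spectrum(1) \<mu>(2))
    then obtain v where "v \<noteq> 0" "(L - \<mu> *\<^sub>R mat 1) *v v = 0"
      by (metis invertible_det_nz invertible_left_inverse matrix_left_invertible_ker)
    then have v: "L *v v = \<mu> *\<^sub>R v" "v \<noteq> 0"
      by (auto simp: matrix_vector_mult_diff_rdistrib scaleR_matrix_vector_assoc[symmetric])
    show ?thesis
      by (rule not_lyap_stable_if_cubic[OF flow[folded X_def] Xxe dX \<mu>(1) _ v])
         (simp add: spectrum(2) \<mu>(2))
  qed
  then show ?thesis by (simp add: lin spectrum(1))
qed

end
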